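(* Let $f\in L^2(I)$. A polynomial $g\in P_n$ is the solution to PBEP(n) if and only if the following two conditions hold: (i) $\|g\|_{L^\infty(J)}\le 1$; (ii) there exist a set of $r$ distinct points $x_1,\dots,x_r\in E(g)$ and non-negative real numbers $\lambda_1,\dots,\lambda_r$, with $0\le r\le 2n+2$, such that $$\langle g-f,h\rangle_I+\sum_{j=1}^r\lambda_j\,g(x_j)\overline{h(x_j)}=0\qquad\text{for all }h\in P_n.$$ Moreover, the $\lambda_j$'s meet the following bound: $$\sum_{j=1}^r\lambda_j\le 2\|f\|_{L^2(I)}^2 .$$ The set of extremal points $\{x_j:\ j=1,\dots,r\}$ is possibly empty (i.e. $r=0$).
   Context: $\mathbb{T}$ is the unit circle, $I\subset\mathbb{T}$ is a finite union of nonempty open arcs whose complement $J=\mathbb{T}\setminus I$ has nonempty interior (in $\mathbb{T}$). All functions are complex-valued. $\|f\|_{L^2(I)}=\left(\frac1{2\pi}\int_I|f(e^{i\theta})|^2\,d\theta\right)^{1/2}$, $\|g\|_{L^\infty(J)}$ is the essential supremum of $|g|$ on $J$ with respect to Lebesgue measure, and $\langle u,v\rangle_I=\frac1{2\pi}\int_I u(e^{i\theta})\overline{v(e^{i\theta})}\,d\theta$. $P_n$ is the space of complex algebraic polynomials of degree at most $n$. For $g\in P_n$, define $E(g)=\{x\in J:\ |g(x)|=\|g\|_{L^\infty(J)}\}$, the set of extremal points of $g$ on $J$. Problem PBEP(n): for $f\in L^2(I)$, find $k_n\in P_n$ such that $|k_n(e^{i\theta})|\le 1$ for a.e. $e^{i\theta}\in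 J$ and $$\|f-k_n\|_{L^2(I)}=\inf\{\|f-g\|_{L^2(I)}:\ g\in P_n,\ |g|\le 1\text{ a.e. on }J\}.$$ This problem has a unique solution.
   Formalization: In (ii), it is required in addition that the sup norm of g on J equals 1 if r>0 and that each x_j is a limit point of J; the bound on the λ_j's excludes g=0 with r>0. As printed, the "if" part and the bound fail in these degenerate cases. *)

theory Defs
  imports
    "HOL-Probability.Essential_Supremum"
    "HOL-Computational_Algebra.Polynomial"
begin

abbreviation unit_circle :: "complex set" where
  "unit_circle \<equiv> sphere 0 1"

(* Normalized Lebesgue measure d\<theta>/(2 pi) on the unit circle, living on the type complex.
   It is completed so that measurability and null sets are those of Lebesgue. *)
definition circle_measure :: "complex measure" where
  "circle_measure = completion (distr (uniform_measure lborel {0..<2 * pi}) borel cis)"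

definition open_arc :: "complex set \<Rightarrow> bool" where
  "open_arc A \<longleftrightarrow> (\<exists>a b. a < b \<and> b \<le> a + 2 * pi \<and> A = cis ` {a<..<b})"

definition finite_union_of_open_arcs :: "complex set \<Rightarrow> bool" where
  "finite_union_of_open_arcs I \<longleftrightarrow>
     (\<exists>\<A>. finite \<A> \<and> \<A> \<noteq> {} \<and> (\<forall>A\<in>\<A>. open_arc A) \<and> I = \<Union>\<A>)"

definition L2_on :: "complex set \<Rightarrow> (complex \<Rightarrow> complex) \<Rightarrow> bool" where
  "L2_on I f \<longleftrightarrow> set_borel_measurable circle_measure I f \<and>
     set_integrable circle_measure I (\<lambda>z. (cmod (f z))\<^sup>2)"

definition L2_norm_on :: "complex set \<Rightarrow> (complex \<Rightarrow> complex) \<Rightarrow> real" where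
  "L2_norm_on I f = sqrt (LINT z:I|circle_measure. (cmod (f z))\<^sup>2)"

definition L2_inner_on ::
    "complex set \<Rightarrow> (complex \<Rightarrow> complex) \<Rightarrow> (complex \<Rightarrow> complex) \<Rightarrow> complex" where
  "L2_inner_on I u v = (LINT z:I|circle_measure. u z * cnj (v z))"

definition Linf_norm_on :: "complex set \<Rightarrow> (complex \<Rightarrow> complex) \<Rightarrow> ereal" where
  "Linf_norm_on J g = esssup (restrict_space circle_measure J) (\<lambda>z. ereal (cmod (g z)))"

definition extremal_points :: "complex set \<Rightarrow> complex poly \<Rightarrow> complex set" where
  "extremal_points J g = {x \<in> J. ereal (cmod (poly g x)) = Linf_norm_on J (poly g)}"

definition PBEP_feasible :: "complex set \<Rightarrow> nat \<Rightarrow> complex poly set" where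
  "PBEP_feasible J n =
     {g. degree g \<le> n \<and> (AE z in circle_measure. z \<in> J \<longrightarrow> cmod (poly g z) \<le> 1)}"

definition PBEP_solution ::
    "complex set \<Rightarrow> complex set \<Rightarrow> nat \<Rightarrow> (complex \<Rightarrow> complex) \<Rightarrow> complex poly \<Rightarrow> bool" where
  "PBEP_solution I J n f k \<longleftrightarrow> k \<in> PBEP_feasible J n \<and>
     L2_norm_on I (\<lambda>z. f z - poly k z) =
       (INF g\<in>PBEP_feasible J n. L2_norm_on I (\<lambda>z. f z - poly g z))"

(* On its own the following condition does not make a feasible g optimal, in two degenerate
   situations: if the norm of g on J is below 1 (its extremal points are then not points where
   the constraint is active), or if some x j is an isolated point of J (two arcs of I sharing an
   end point leave such a point, which the almost-everywhere constraint does not see). Both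
   have to be excluded where sufficiency is claimed. *)
definition PBEP_multipliers ::
    "complex set \<Rightarrow> complex set \<Rightarrow> nat \<Rightarrow> (complex \<Rightarrow> complex) \<Rightarrow> complex poly \<Rightarrow>
     nat \<Rightarrow> (nat \<Rightarrow> complex) \<Rightarrow> (nat \<Rightarrow> real) \<Rightarrow> bool" where
  "PBEP_multipliers I J n f g r x l \<longleftrightarrow>
     r \<le> 2 * n + 2 \<and>
     inj_on x {1..r} \<and>
     (\<forall>j\<in>{1..r}. x j \<in> extremal_points J g) \<and>
     (\<forall>j\<in>{1..r}. 0 \<le> l j) \<and>
     (\<forall>h. degree h \<le> n \<longrightarrow>
        L2_inner_on I (\<lambda>z. poly g z - f z) (poly h) +
          (\<Sum>j = 1..r. of_real (l j) * poly g (x j) * cnj (poly h (x j))) = 0)"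

end

(* At a solution g, every direction h in P_n with Re (g(x) cnj (h(x))) <= 0 on the contact set
   {x : |g(x)| = 1} (x a limit point of J) satisfies Re <g - f, h> >= 0: subtracting a small
   multiple of g from h makes the inequality strict, and then g + t h is feasible for small t > 0.
   By Farkas' lemma, h |-> -Re <g - f, h> therefore lies in the cone generated by the functionals
   h |-> Re (g(x) cnj (h(x))) with x in the contact set. This cone is closed because the contact set
   is compact and h = g takes the value 1 on all generators; Caratheodory's theorem in real dimension
   2 n + 2 bounds the number of points. Sufficiency is convexity, and testing with h = g gives the
   bound on the multipliers. *)
theory Submission
  imports Defs "HOL-Probability.Probability_Measure"
begin

section \<open>Farkas' lemma for a cone with compact base\<close>

text \<open>The constraint holds only almost everywhere, whereas Farkas' lemma needs functionals at
  points. The derived set of \<open>J\<close> mediates. It is compact, and it exhausts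
  \<open>J\<close> up to finitely many points because the closures of the arcs add only end points.
  Feasibility of a polynomial is therefore the pointwise bound on this set. A direction that merely
  fails to ascend at first order can leave the feasible set through the term t^2 |h|^2. This is why
  descent must be strict, and uniform over the contact set, before perturbing. The cone may have
  infinitely many generators, so its closedness needs an argument: the distance to it is minimized
  over tuples of generators with bounded weights, a compact space. Caratheodory's theorem thus
  serves twice, to fix the length of the tuples and to count the final points.\<close>

lemma homogeneous_system_nontrivial:
  fixes v :: "'a \<Rightarrow> 'i \<Rightarrow> real"
  assumes "finite B" "finite F" "card B < card F"
  shows "\<exists>\<mu>. (\<exists>x\<in>F. \<mu> x \<noteq> 0) \<and> (\<forall>i\<in>B. (\<Sum>x\<in>F. \<mu> x * v x i) = 0)"
  using assms
proof (induction B arbitrary: F v rule: finite_induct)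
  case empty
  then have "F \<noteq> {}" by auto
  then show ?case by (intro exI[of _ "\<lambda>_. 1"]) auto
next
  case (insert b B)
  show ?case
  proof (cases "\<forall>x\<in>F. v x b = 0")
    case True
    obtain \<mu> where "\<exists>x\<in>F. \<mu> x \<noteq> 0" "\<forall>i\<in>B. (\<Sum>x\<in>F. \<mu> x * v x i) = 0"
      using insert.IH[of F v] insert.prems insert.hyps by auto
    then show ?thesis using True by (intro exI[of _ \<mu>]) auto
  next
    case False
    then obtain y where y: "y \<in> F" "v y b \<noteq> 0" by auto
    \<comment> \<open>Gaussian elimination: equation \<open>b\<close> is solved for the unknown
      \<open>y\<close>, and \<open>v'\<close> holds the coefficients of the other equations after
      substitution. One equation and one unknown disappear together.\<close>
    define v' where "v' x i = v x i - v x b / v y b * v y i" for x i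
    have "card B < card (F - {y})"
      using insert.prems insert.hyps y(1) by simp
    then obtain \<mu> where \<mu>: "\<exists>x\<in>F - {y}. \<mu> x \<noteq> 0" "\<forall>i\<in>B. (\<Sum>x\<in>F - {y}. \<mu> x * v' x i) = 0"
      using insert.IH[of "F - {y}" v'] insert.prems by auto
    define c where "c = - (\<Sum>x\<in>F - {y}. \<mu> x * v x b) / v y b"
    define \<nu> where "\<nu> = \<mu>(y := c)"
    have split: "(\<Sum>x\<in>F. \<nu> x * v x i) = c * v y i + (\<Sum>x\<in>F - {y}. \<mu> x * v x i)" for i
      unfolding sum.remove[OF insert.prems(1) y(1)] by (auto simp: \<nu>_def intro!: sum.cong)
    have "(\<Sum>x\<in>F. \<nu> x * v x i) = (\<Sum>x\<in>F - {y}. \<mu> x * v' x i)" for i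
      unfolding split c_def v'_def
      by (simp add: sum_subtractf right_diff_distrib sum_divide_distrib sum_distrib_right mult.assoc
          sum_negf)
    moreover have "(\<Sum>x\<in>F. \<nu> x * v x b) = 0"
      unfolding split c_def using y(2) by simp
    ultimately have "\<forall>i\<in>insert b B. (\<Sum>x\<in>F. \<nu> x * v x i) = 0"
      using \<mu>(2) by auto
    moreover have "\<exists>x\<in>F. \<nu> x \<noteq> 0" using \<mu>(1) by (auto simp: \<nu>_def)
    ultimately show ?thesis by blast
  qed
qed

text \<open>A combination of too many generators is shifted along a linear dependence until a first
  coefficient reaches zero; that generator is dropped.\<close>

lemma conic_caratheodory:
  fixes v :: "'a \<Rightarrow> 'i \<Rightarrow> real"
  assumes "finite B" "finite F" "\<forall>x\<in>F. 0 \<le> l x"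
  shows "\<exists>G m. G \<subseteq> F \<and> card G \<le> card B \<and> (\<forall>x\<in>G. 0 \<le> m x) \<and>
           (\<forall>i\<in>B. (\<Sum>x\<in>G. m x * v x i) = (\<Sum>x\<in>F. l x * v x i))"
  using assms(2,3)
proof (induction "card F" arbitrary: F l rule: less_induct)
  case less
  show ?case
  proof (cases "card F \<le> card B")
    case True
    then show ?thesis using less.prems by blast
  next
    case False
    then obtain \<mu>0 where \<mu>0: "\<exists>x\<in>F. \<mu>0 x \<noteq> 0" "\<forall>i\<in>B. (\<Sum>x\<in>F. \<mu>0 x * v x i) = 0"
      using homogeneous_system_nontrivial[OF assms(1) less.prems(1), of v] by auto
    \<comment> \<open>The sign is chosen so that some coefficient decreases along the shift and is
      eventually exhausted.\<close>
    obtain \<mu> where \<mu>: "\<exists>x\<in>F. \<mu> x > 0" "\<forall>i\<in>B. (\<Sum>x\<in>F. \<mu> x * v x i) = 0"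
    proof (cases "\<exists>x\<in>F. \<mu>0 x > 0")
      case True
      then show ?thesis using that \<mu>0 by blast
    next
      case False
      then have "\<exists>x\<in>F. - \<mu>0 x > 0" using \<mu>0(1) by force
      moreover have "\<forall>i\<in>B. (\<Sum>x\<in>F. - \<mu>0 x * v x i) = 0" using \<mu>0(2) by (simp add: sum_negf)
      ultimately show ?thesis using that[of "\<lambda>x. - \<mu>0 x"] by blast
    qed
    let ?P = "{x\<in>F. \<mu> x > 0}"
    have P: "finite ?P" "?P \<noteq> {}" using less.prems \<mu>(1) by auto
    \<comment> \<open>Ratio test: the least quotient is the largest step that keeps all coefficients
      nonnegative, and its minimizer \<open>y\<close> drops out.\<close>
    let ?Q = "(\<lambda>x. l x / \<mu> x) ` ?P"
    have "Min ?Q \<in> ?Q" using P by (intro Min_in) auto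
    then obtain y where y: "y \<in> ?P" and ly: "l y / \<mu> y = Min ?Q" by auto
    then have ymin: "l y / \<mu> y \<le> l x / \<mu> x" if "x \<in> ?P" for x
      using that P by (simp only: ly) (rule Min_le, auto)
    define t where "t = l y / \<mu> y"
    define m where "m x = l x - t * \<mu> x" for x
    have t0: "0 \<le> t" using y less.prems by (auto simp: t_def)
    have m0: "0 \<le> m x" if x: "x \<in> F" for x
    proof (cases "\<mu> x > 0")
      case True
      then have "t \<le> l x / \<mu> x" using ymin x by (auto simp: t_def)
      then show ?thesis using True by (simp add: m_def field_simps)
    next
      case False
      then have "t * \<mu> x \<le> 0" using t0 by (simp add: mult_nonneg_nonpos)
      then show ?thesis using less.prems(2) x by (force simp: m_def)
    qed
    have my: "m y = 0" using y by (simp add: m_def t_def)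
    have "y \<in> F" using y by simp
    have eq: "(\<Sum>x\<in>F - {y}. m x * v x i) = (\<Sum>x\<in>F. l x * v x i)" if "i \<in> B" for i
    proof -
      have "(\<Sum>x\<in>F. m x * v x i) = (\<Sum>x\<in>F. l x * v x i) - t * (\<Sum>x\<in>F. \<mu> x * v x i)"
        by (simp add: m_def left_diff_distrib sum_subtractf sum_distrib_left mult.assoc)
      then show ?thesis
        using \<mu>(2) that my sum.remove[OF less.prems(1) \<open>y \<in> F\<close>, of "\<lambda>x. m x * v x i"] by simp
    qed
    have "card (F - {y}) < card F" using \<open>y \<in> F\<close> less.prems(1) by (meson card_Diff1_less)
    then obtain G m' where "G \<subseteq> F - {y}" "card G \<le> card B" "\<forall>x\<in>G. 0 \<le> m' x"
        "\<forall>i\<in>B. (\<Sum>x\<in>G. m' x * v x i) = (\<Sum>x\<in>F - {y}. m x * v x i)"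
      using less.hyps[of "F - {y}" m] less.prems(1) m0 by auto
    then show ?thesis using eq by (intro exI[of _ G] exI[of _ m']) auto
  qed
qed

section \<open>Cones with compact base: nearest point and separation\<close>

lemma nonneg_slope_at_zero:
  fixes a b d :: real
  assumes d: "0 < d" and ge: "\<And>t. 0 < t \<Longrightarrow> t < d \<Longrightarrow> 0 \<le> 2 * t * a + t\<^sup>2 * b"
  shows "0 \<le> a"
proof (rule tendsto_lowerbound[where F = "at_right 0"])
  show "((\<lambda>t. a + t * b / 2) \<longlongrightarrow> a) (at_right 0)"
    by (auto intro!: tendsto_eq_intros)
  show "\<forall>\<^sub>F t in at_right 0. 0 \<le> a + t * b / 2"
    unfolding eventually_at_right_field
  proof (intro exI[of _ d] conjI allI impI d)
    fix t :: real assume t: "0 < t" "t < d"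
    \<comment> \<open>Dividing by 2t leaves an expression with limit \<open>a\<close> as t tends to
      0 from the right; \<open>b\<close> may have any sign.\<close>
    have "0 \<le> 2 * t * (a + t * b / 2)"
      using ge[OF t] by (simp add: algebra_simps power2_eq_square)
    then show "0 \<le> a + t * b / 2" using t by (simp add: zero_le_mult_iff)
  qed
qed simp

text \<open>Vectors of R^B are encoded as functions compared only on \<open>B\<close>, so that the
  dimension \<open>card B\<close> can vary with the degree bound.\<close>

definition cone_over :: "'i set \<Rightarrow> 'a set \<Rightarrow> ('a \<Rightarrow> 'i \<Rightarrow> real) \<Rightarrow> ('i \<Rightarrow> real) set" where
  "cone_over B K v = {p. \<exists>F l. finite F \<and> F \<subseteq> K \<and> (\<forall>x\<in>F. 0 \<le> l x) \<and>
     (\<forall>i\<in>B. p i = (\<Sum>x\<in>F. l x * v x i))}"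

lemma cone_over_add_generator:
  assumes p: "p \<in> cone_over B K v" and x: "x \<in> K" and t: "0 \<le> t"
  shows "(\<lambda>i. p i + t * v x i) \<in> cone_over B K v"
proof -
  obtain F l where F: "finite F" "F \<subseteq> K" "\<forall>x\<in>F. 0 \<le> l x" "\<forall>i\<in>B. p i = (\<Sum>x\<in>F. l x * v x i)"
    using p by (auto simp: cone_over_def)
  \<comment> \<open>If \<open>x\<close> already carries weight, the new weight is added to it, since
    a combination lists each generator once.\<close>
  define m where "m y = (if y \<in> F then l y else 0) + (if y = x then t else 0)" for y
  have eq: "p i + t * v x i = (\<Sum>y\<in>insert x F. m y * v y i)" if i: "i \<in> B" for i
  proof -
    have "(\<Sum>y\<in>insert x F. m y * v y i) =
        (\<Sum>y\<in>insert x F. if y \<in> F then l y * v y i else 0) +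
        (\<Sum>y\<in>insert x F. if y = x then t * v x i else 0)"
      unfolding sum.distrib[symmetric] by (intro sum.cong) (auto simp: m_def distrib_right)
    also have "(\<Sum>y\<in>insert x F. if y \<in> F then l y * v y i else 0) = (\<Sum>y\<in>F. l y * v y i)"
      using F(1) by (intro sum.mono_neutral_cong_right) auto
    also have "(\<Sum>y\<in>insert x F. if y = x then t * v x i else 0) = t * v x i"
      using F(1) by (simp add: sum.delta)
    finally show ?thesis using F(4) i by simp
  qed
  show ?thesis unfolding cone_over_def
    using F x t eq by (intro CollectI exI[of _ "insert x F"] exI[of _ m]) (auto simp: m_def)
qed

lemma cone_over_scale:
  assumes p: "p \<in> cone_over B K v" and t: "0 \<le> t"
  shows "(\<lambda>i. t * p i) \<in> cone_over B K v"
proof -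
  obtain F l where F: "finite F" "F \<subseteq> K" "\<forall>x\<in>F. 0 \<le> l x" "\<forall>i\<in>B. p i = (\<Sum>x\<in>F. l x * v x i)"
    using p by (auto simp: cone_over_def)
  show ?thesis unfolding cone_over_def
    using F t by (intro CollectI exI[of _ F] exI[of _ "\<lambda>x. t * l x"])
      (auto simp: sum_distrib_left mult.assoc)
qed

lemma cone_over_zero: "(\<lambda>i. 0) \<in> cone_over B K v"
  unfolding cone_over_def by (auto intro!: exI[of _ "{}"])

text \<open>Tuples, with repetitions allowed, replace finite sets of generators because they range
  over a product space, where compactness is available.\<close>

lemma cone_over_tuple:
  fixes s :: "nat \<Rightarrow> real \<times> 'a"
  assumes s: "\<And>j. s j \<in> {0..} \<times> K"
  shows "(\<lambda>i. \<Sum>j<N. fst (s j) * v (snd (s j)) i) \<in> cone_over B K v"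
proof (induction N)
  case 0
  show ?case using cone_over_zero by simp
next
  case (Suc N)
  then show ?case using cone_over_add_generator[OF Suc, of "snd (s N)" "fst (s N)"] s[of N]
    by (auto simp: mem_Times_iff)
qed

text \<open>Since \<open>e\<close> is 1 on every generator, its value at \<open>p\<close> is the
  total weight, and \<open>R\<close> bounds each single weight. Caratheodory's theorem bounds the
  number of generators.\<close>

lemma cone_over_tuple_ex:
  assumes B: "finite B" and K: "k0 \<in> K" and p: "p \<in> cone_over B K v"
    and e: "\<And>x. x \<in> K \<Longrightarrow> (\<Sum>i\<in>B. v x i * e i) = 1" and R: "(\<Sum>i\<in>B. p i * e i) \<le> R"
    and R0: "0 \<le> R"
  obtains s :: "nat \<Rightarrow> real \<times> 'a" where "\<And>j. s j \<in> {0..R} \<times> K"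
    "\<And>i. i \<in> B \<Longrightarrow> p i = (\<Sum>j<card B. fst (s j) * v (snd (s j)) i)"
proof -
  obtain F0 l0 where F0: "finite F0" "F0 \<subseteq> K" "\<forall>x\<in>F0. 0 \<le> l0 x"
      "\<forall>i\<in>B. p i = (\<Sum>x\<in>F0. l0 x * v x i)"
    using p by (auto simp: cone_over_def)
  obtain F l where F: "F \<subseteq> F0" "card F \<le> card B" "\<forall>x\<in>F. 0 \<le> l x"
      "\<forall>i\<in>B. (\<Sum>x\<in>F. l x * v x i) = (\<Sum>x\<in>F0. l0 x * v x i)"
    using conic_caratheodory[OF B F0(1,3)] by blast
  have finF: "finite F" using F F0 finite_subset by blast
  have FK: "F \<subseteq> K" using F F0 by blast
  have pF: "p i = (\<Sum>x\<in>F. l x * v x i)" if "i \<in> B" for i using F0(4) F(4) that by simp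
  have "(\<Sum>i\<in>B. p i * e i) = (\<Sum>i\<in>B. \<Sum>x\<in>F. l x * (v x i * e i))"
    by (intro sum.cong refl) (simp add: pF sum_distrib_right mult.assoc)
  also have "\<dots> = (\<Sum>x\<in>F. l x * (\<Sum>i\<in>B. v x i * e i))"
    by (subst sum.swap) (simp add: sum_distrib_left)
  also have "\<dots> = sum l F" using e FK by (intro sum.cong) auto
  finally have "sum l F \<le> R" using R by simp
  then have lR: "l x \<le> R" if "x \<in> F" for x
    using member_le_sum[of x F l] F(3) that finF by fastforce
  obtain b where b: "bij_betw b {0..<card F} F" using ex_bij_betw_nat_finite[OF finF] by blast
  \<comment> \<open>Tuples have the fixed length \<open>card B\<close>; missing entries get weight 0
    at the arbitrary point \<open>k0\<close>.\<close>
  define s where "s j = (if j < card F then (l (b j), b j) else (0, k0))" for j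
  have bF: "b j \<in> F" if "j < card F" for j using b that by (auto simp: bij_betw_def)
  have "(\<Sum>j<card B. fst (s j) * v (snd (s j)) i) = (\<Sum>j\<in>{0..<card F}. l (b j) * v (b j) i)" for i
    using F(2) by (intro sum.mono_neutral_cong_right) (auto simp: s_def)
  also have "\<dots> i = (\<Sum>x\<in>F. l x * v x i)" for i
    by (rule sum.reindex_bij_betw[OF b, of "\<lambda>x. l x * v x i"])
  finally show ?thesis
    using bF F(3) FK K lR R0 by (intro that[of s]) (auto simp: s_def pF)
qed

lemma cone_over_nearest_point:
  fixes v :: "'a::topological_space \<Rightarrow> 'i \<Rightarrow> real"
  assumes B: "finite B" and K: "compact K" "K \<noteq> {}"
    and cont: "\<And>i. i \<in> B \<Longrightarrow> continuous_on K (\<lambda>x. v x i)"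
    and e: "\<And>x. x \<in> K \<Longrightarrow> (\<Sum>i\<in>B. v x i * e i) = 1"
  obtains p where "p \<in> cone_over B K v"
    "\<And>q. q \<in> cone_over B K v \<Longrightarrow> (\<Sum>i\<in>B. (w i - p i)\<^sup>2) \<le> (\<Sum>i\<in>B. (w i - q i)\<^sup>2)"
proof -
  \<comment> \<open>\<open>W\<close> is the norm of \<open>w\<close>. A point \<open>q\<close> no
    farther from \<open>w\<close> than the origin has coordinates of modulus at most 2W, so its
    pairing with \<open>e\<close> is at most \<open>R\<close>.\<close>
  define W where "W = sqrt (\<Sum>i\<in>B. (w i)\<^sup>2)"
  define R where "R = (\<Sum>i\<in>B. 2 * W * \<bar>e i\<bar>)"
  have W0: "0 \<le> W" by (simp add: W_def sum_nonneg)
  have R0: "0 \<le> R" using W0 by (auto simp: R_def intro!: sum_nonneg)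
  define D where "D q = (\<Sum>i\<in>B. (w i - q i)\<^sup>2)" for q
  have mass: "(\<Sum>i\<in>B. q i * e i) \<le> R" if q: "D q \<le> D (\<lambda>i. 0)" for q
    unfolding R_def
  proof (rule sum_mono)
    fix i assume i: "i \<in> B"
    have bnd: "\<bar>c i\<bar> \<le> W" if "(\<Sum>i\<in>B. (c i)\<^sup>2) \<le> (\<Sum>i\<in>B. (w i)\<^sup>2)" for c
    proof -
      have "(c i)\<^sup>2 \<le> (\<Sum>i\<in>B. (w i)\<^sup>2)"
        using member_le_sum[OF i, of "\<lambda>i. (c i)\<^sup>2"] B that by simp
      then show ?thesis unfolding W_def by (metis real_sqrt_abs real_sqrt_le_iff)
    qed
    have "\<bar>q i\<bar> \<le> 2 * W"
      using bnd[of w] bnd[of "\<lambda>i. w i - q i"] q by (auto simp: D_def)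
    then have "\<bar>q i\<bar> * \<bar>e i\<bar> \<le> 2 * W * \<bar>e i\<bar>" by (simp add: mult_right_mono)
    then show "q i * e i \<le> 2 * W * \<bar>e i\<bar>" by (metis abs_le_D1 abs_mult)
  qed
  define P where "P s i = (\<Sum>j<card B. fst (s j) * v (snd (s j)) i)" for s :: "nat \<Rightarrow> real \<times> 'a" and i
  \<comment> \<open>Infinite sequences, of which \<open>P\<close> reads only the first
    \<open>card B\<close> terms; the product is compact by Tychonoff's theorem.\<close>
  define X :: "(nat \<Rightarrow> real \<times> 'a) set" where "X = (\<Pi>\<^sub>E j\<in>UNIV. {0..R} \<times> K)"
  have "compact ({0..R} \<times> K)" using K by (intro compact_Times) auto
  then have cX: "compact X"
    unfolding X_def using compactin_PiE[of "\<lambda>_. euclidean" UNIV "\<lambda>_::nat. {0..R} \<times> K"]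
    by (auto simp: euclidean_product_topology)
  obtain k0 where k0: "k0 \<in> K" using K by auto
  then have "(\<lambda>_. (0, k0)) \<in> X" using R0 by (auto simp: X_def)
  then have neX: "X \<noteq> {}" by blast
  have contP: "continuous_on X (\<lambda>s. P s i)" if i: "i \<in> B" for i
    unfolding P_def
  proof (intro continuous_on_sum continuous_on_mult)
    fix j
    have c: "continuous_on X (\<lambda>s. s j)"
      by (rule continuous_on_subset[OF continuous_on_product_coordinates]) auto
    show "continuous_on X (\<lambda>s. fst (s j))" by (rule continuous_on_fst[OF c])
    show "continuous_on X (\<lambda>s. v (snd (s j)) i)"
      by (rule continuous_on_compose2[OF cont[OF i] continuous_on_snd[OF c]])
        (fastforce simp: X_def PiE_iff mem_Times_iff)
  qed
  have "continuous_on X (\<lambda>s. D (P s))" unfolding D_def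
    by (intro continuous_intros contP)
  then obtain s where s: "s \<in> X" and smin: "\<And>s'. s' \<in> X \<Longrightarrow> D (P s) \<le> D (P s')"
    using continuous_attains_inf[OF cX neX] by blast
  have "s j \<in> {0..} \<times> K" for j
    using s unfolding X_def PiE_iff mem_Times_iff by auto
  then have "P s \<in> cone_over B K v" unfolding P_def[abs_def] by (rule cone_over_tuple)
  moreover have below: "D (P s) \<le> D q" if q: "q \<in> cone_over B K v" "D q \<le> D (\<lambda>i. 0)" for q
  proof -
    obtain s' where s': "\<And>j. s' j \<in> {0..R} \<times> K" "\<And>i. i \<in> B \<Longrightarrow> q i = P s' i"
      using cone_over_tuple_ex[OF B k0 q(1) e mass[OF q(2)] R0] unfolding P_def by metis
    have "D q = D (P s')" using s'(2) by (simp add: D_def)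
    moreover have "s' \<in> X" unfolding X_def PiE_UNIV_domain Pi_iff using s'(1) by blast
    ultimately show ?thesis using smin by simp
  qed
  \<comment> \<open>Points farther from \<open>w\<close> than the origin are handled by comparison
    with the origin, which lies in the cone.\<close>
  moreover have "D (P s) \<le> D q" if "q \<in> cone_over B K v" for q
    using below[OF that] below[OF cone_over_zero] by linarith
  ultimately show ?thesis using that unfolding D_def by blast
qed

text \<open>Let \<open>p\<close> be the nearest point and \<open>u = w - p\<close>. Adding
  generators to \<open>p\<close> shows that \<open>u\<close> is nonpositive on them, so
  \<open>dual\<close> makes w.u nonpositive; shrinking \<open>p\<close> inside the cone makes p.u
  nonnegative. Hence |u|^2 = w.u - p.u <= 0.\<close>

lemma farkas_compact_base:
  fixes v :: "'a::topological_space \<Rightarrow> 'i \<Rightarrow> real"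
  assumes B: "finite B" and K: "compact K"
    and cont: "\<And>i. i \<in> B \<Longrightarrow> continuous_on K (\<lambda>x. v x i)"
    and e: "\<And>x. x \<in> K \<Longrightarrow> (\<Sum>i\<in>B. v x i * e i) = 1"
    and dual: "\<And>h. (\<And>x. x \<in> K \<Longrightarrow> (\<Sum>i\<in>B. v x i * h i) \<le> 0) \<Longrightarrow> (\<Sum>i\<in>B. w i * h i) \<le> 0"
  obtains F l where "finite F" "F \<subseteq> K" "card F \<le> card B" "\<And>x. x \<in> F \<Longrightarrow> 0 \<le> l x"
    "\<And>i. i \<in> B \<Longrightarrow> w i = (\<Sum>x\<in>F. l x * v x i)"
proof -
  obtain p where p: "p \<in> cone_over B K v" and wp: "\<And>i. i \<in> B \<Longrightarrow> w i = p i"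
  proof (cases "K = {}")
    case True
    \<comment> \<open>Without generators the cone is {0}; \<open>dual\<close> then applies vacuously
      to \<open>w\<close> itself.\<close>
    then have "(\<Sum>i\<in>B. (w i)\<^sup>2) \<le> 0" using dual[of w] by (simp add: power2_eq_square)
    then have "(\<Sum>i\<in>B. (w i)\<^sup>2) = 0" by (meson antisym sum_nonneg zero_le_power2)
    then have "w i = 0" if "i \<in> B" for i using B that by (simp add: sum_nonneg_eq_0_iff)
    then show ?thesis using that cone_over_zero by metis
  next
    case False
    obtain p where p: "p \<in> cone_over B K v"
      and pmin: "\<And>q. q \<in> cone_over B K v \<Longrightarrow> (\<Sum>i\<in>B. (w i - p i)\<^sup>2) \<le> (\<Sum>i\<in>B. (w i - q i)\<^sup>2)"
      using cone_over_nearest_point[OF B K False cont e] by metis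
    define u where "u i = w i - p i" for i
    have variation: "0 \<le> (\<Sum>i\<in>B. - (y i * u i))"
      if "\<And>t. 0 < t \<Longrightarrow> t < 1 \<Longrightarrow> (\<lambda>i. p i + t * y i) \<in> cone_over B K v" for y
    proof (rule nonneg_slope_at_zero[of 1 _ "\<Sum>i\<in>B. (y i)\<^sup>2"])
      fix t :: real assume t: "0 < t" "t < 1"
      have "0 \<le> (\<Sum>i\<in>B. (w i - (p i + t * y i))\<^sup>2) - (\<Sum>i\<in>B. (w i - p i)\<^sup>2)"
        using pmin[OF that[OF t]] by simp
      also have "\<dots> = (\<Sum>i\<in>B. 2 * t * - (y i * u i) + t\<^sup>2 * (y i)\<^sup>2)"
        unfolding sum_subtractf[symmetric]
        by (intro sum.cong) (auto simp: u_def power2_eq_square algebra_simps)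
      finally show "0 \<le> 2 * t * (\<Sum>i\<in>B. - (y i * u i)) + t\<^sup>2 * (\<Sum>i\<in>B. (y i)\<^sup>2)"
        by (simp only: sum.distrib sum_distrib_left)
    qed simp
    have "(\<Sum>i\<in>B. v x i * u i) \<le> 0" if "x \<in> K" for x
      using variation[of "v x"] cone_over_add_generator[OF p that] by (simp add: sum_negf)
    then have "(\<Sum>i\<in>B. w i * u i) \<le> 0" by (rule dual)
    moreover have "(\<lambda>i. p i + t * - p i) \<in> cone_over B K v" if "0 < t" "t < 1" for t
      using cone_over_scale[OF p, of "1 - t"] that by (simp add: algebra_simps)
    then have "0 \<le> (\<Sum>i\<in>B. p i * u i)"
      using variation[of "\<lambda>i. - p i"] by simp
    moreover have "(\<Sum>i\<in>B. (u i)\<^sup>2) = (\<Sum>i\<in>B. w i * u i) - (\<Sum>i\<in>B. p i * u i)"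
      unfolding sum_subtractf[symmetric] by (auto simp: u_def power2_eq_square algebra_simps)
    ultimately have "(\<Sum>i\<in>B. (u i)\<^sup>2) \<le> 0" by linarith
    then have "(\<Sum>i\<in>B. (u i)\<^sup>2) = 0" by (meson antisym sum_nonneg zero_le_power2)
    then have "w i = p i" if "i \<in> B" for i using B that by (simp add: sum_nonneg_eq_0_iff u_def)
    then show ?thesis using that p by blast
  qed
  obtain F l where F: "finite F" "F \<subseteq> K" "\<forall>x\<in>F. 0 \<le> l x" "\<forall>i\<in>B. p i = (\<Sum>x\<in>F. l x * v x i)"
    using p by (auto simp: cone_over_def)
  obtain G m where "G \<subseteq> F" "card G \<le> card B" "\<forall>x\<in>G. 0 \<le> m x"
      "\<forall>i\<in>B. (\<Sum>x\<in>G. m x * v x i) = (\<Sum>x\<in>F. l x * v x i)"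
    using conic_caratheodory[OF B F(1,3)] by blast
  then show ?thesis using F wp by (intro that[of G m]) (auto intro: finite_subset)
qed

section \<open>The circle measure and complements of arcs\<close>

lemma cis_eq_cis_iff: "cis s = cis t \<longleftrightarrow> (\<exists>k::int. s = t + 2 * pi * k)"
  using sin_cos_eq_iff[of s t] by (auto simp: complex_eq_iff)

lemma cis_inj_within_period:
  assumes "cis s = cis t" "\<bar>s - t\<bar> < 2 * pi"
  shows "s = t"
proof -
  obtain k :: int where k: "s = t + 2 * pi * k" using assms cis_eq_cis_iff by auto
  then have "2 * pi * \<bar>real_of_int k\<bar> < 2 * pi * 1" using assms(2) by (simp add: abs_mult)
  then have "\<bar>real_of_int k\<bar> < 1" by (simp only: mult_less_cancel_left) auto
  then have "k = 0" by linarith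
  then show ?thesis using k by simp
qed

lemma unit_circle_cis_from:
  assumes "z \<in> unit_circle"
  obtains t where "a \<le> t" "t < a + 2 * pi" "cis t = z"
proof -
  define s where "s = Arg z"
  have "cis s = sgn z" unfolding s_def using assms by (intro cis_Arg) auto
  then have s: "cis s = z" using assms by (simp add: sgn_eq)
  define k where "k = \<lfloor>(s - a) / (2 * pi)\<rfloor>"
  have "real_of_int k \<le> (s - a) / (2 * pi)" "(s - a) / (2 * pi) < real_of_int k + 1"
    unfolding k_def by linarith+
  then have "2 * pi * real_of_int k \<le> s - a" "s - a < 2 * pi * (real_of_int k + 1)"
    by (simp_all add: field_simps)
  moreover have "cis (s - 2 * pi * real_of_int k) = cis s"
    unfolding cis_eq_cis_iff by (intro exI[of _ "- k"]) simp
  ultimately show ?thesis using s by (intro that[of "s - 2 * pi * k"]) (auto simp: algebra_simps)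
qed

text \<open>Relative openness of an arc will follow from compactness of the complementary closed
  arc. The parameter \<open>a + 2 * pi\<close> represents the same point as \<open>a\<close>; for
  \<open>b = a + 2 * pi\<close> only this point is removed.\<close>

lemma open_arc_eq_Diff_compact:
  assumes "a < b" "b \<le> a + 2 * pi"
  shows "cis ` {a<..<b} = unit_circle - cis ` {b..a + 2 * pi}"
proof (intro equalityI subsetI)
  fix z assume "z \<in> cis ` {a<..<b}"
  then obtain t where t: "a < t" "t < b" "z = cis t" by auto
  have "cis t \<noteq> cis s" if "s \<in> {b..a + 2 * pi}" for s
    using cis_inj_within_period[of t s] that t by auto
  then have "z \<notin> cis ` {b..a + 2 * pi}" unfolding t(3) image_iff by metis
  then show "z \<in> unit_circle - cis ` {b..a + 2 * pi}" using t(3) by simp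
next
  fix z assume z: "z \<in> unit_circle - cis ` {b..a + 2 * pi}"
  obtain t where t: "a \<le> t" "t < a + 2 * pi" "cis t = z"
    using unit_circle_cis_from z by blast
  have "t \<noteq> a"
  proof
    assume "t = a"
    then have "z = cis (a + 2 * pi)" using t(3) by (simp flip: cis_mult)
    then show False using z assms by auto
  qed
  moreover have "t < b" using z t by (meson DiffD2 atLeastAtMost_iff image_eqI less_imp_le not_less)
  ultimately show "z \<in> cis ` {a<..<b}" using t by force
qed

lemma compact_cis_image: "compact (cis ` {a..b})"
  by (intro compact_continuous_image continuous_intros) auto

lemma closure_open_arc: "closure (cis ` {a<..<b}) \<subseteq> cis ` {a<..<b} \<union> {cis a, cis b}"
proof -
  have "closure (cis ` {a<..<b}) \<subseteq> cis ` {a..b}"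
    by (intro closure_minimal compact_imp_closed compact_cis_image) auto
  also have "\<dots> \<subseteq> cis ` {a<..<b} \<union> {cis a, cis b}"
    by (auto simp: less_le)
  finally show ?thesis .
qed

lemma finite_union_of_open_arcs_closure:
  assumes "finite_union_of_open_arcs I"
  obtains F where "finite F" "closure I \<subseteq> I \<union> F"
proof -
  obtain \<A> where A: "finite \<A>" "\<forall>A\<in>\<A>. open_arc A" "I = \<Union>\<A>"
    using assms by (auto simp: finite_union_of_open_arcs_def)
  have "\<exists>F. finite F \<and> closure A \<subseteq> A \<union> F" if "A \<in> \<A>" for A
    using A(2) that closure_open_arc unfolding open_arc_def by (metis finite.emptyI finite.insertI)
  then obtain F where F: "\<And>A. A \<in> \<A> \<Longrightarrow> finite (F A)" "\<And>A. A \<in> \<A> \<Longrightarrow> closure A \<subseteq> A \<union> F A"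
    by metis
  have "closure I \<subseteq> (\<Union>A\<in>\<A>. closure A)"
    using A closure_subset by (intro closure_minimal closed_UN) fastforce+
  also have "\<dots> \<subseteq> I \<union> \<Union>(F ` \<A>)" using F(2) A(3) by blast
  finally show ?thesis using A(1) F(1) by (intro that) auto
qed

lemma finite_union_of_open_arcs_openin:
  assumes "finite_union_of_open_arcs I"
  shows "openin (top_of_set unit_circle) I"
proof -
  have "openin (top_of_set unit_circle) A" if arc: "open_arc A" for A
  proof -
    obtain a b where "a < b" "b \<le> a + 2 * pi" "A = cis ` {a<..<b}"
      using arc unfolding open_arc_def by blast
    then have "A = unit_circle \<inter> - cis ` {b..a + 2 * pi}"
      using open_arc_eq_Diff_compact by auto
    then show ?thesis
      using openin_open_Int[of "- cis ` {b..a + 2 * pi}" unit_circle]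
        compact_imp_closed[OF compact_cis_image, of b "a + 2 * pi"]
      by (simp add: open_Compl)
  qed
  then show ?thesis using assms unfolding finite_union_of_open_arcs_def by auto
qed

section \<open>Null sets and support of normalized arc length\<close>

lemma space_circle_measure [simp]: "space circle_measure = UNIV"
  by (simp add: circle_measure_def)

lemma borel_in_sets_circle_measure: "A \<in> sets borel \<Longrightarrow> A \<in> sets circle_measure"
  by (simp add: circle_measure_def)

lemma borel_measurable_circle_measure:
  "u \<in> borel_measurable borel \<Longrightarrow> u \<in> borel_measurable circle_measure"
  unfolding circle_measure_def by (intro measurable_completion) simp

lemma measurable_cis: "cis \<in> borel_measurable borel"
  by (intro borel_measurable_continuous_onI continuous_intros)

lemma measurable_cis_uniform: "cis \<in> borel_measurable (uniform_measure lborel A)"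
  using measurable_cis measurable_cong_sets[of "uniform_measure lborel A" borel borel borel] by simp

lemma prob_space_circle_measure: "prob_space circle_measure"
proof -
  interpret U: prob_space "uniform_measure lborel {0..<2 * pi}"
    by (rule prob_space_uniform_measure) auto
  interpret D: prob_space "distr (uniform_measure lborel {0..<2 * pi}) borel cis"
    by (rule U.prob_space_distr) (simp add: measurable_cis_uniform)
  show ?thesis unfolding circle_measure_def by (rule D.prob_space_completion)
qed

interpretation circle: prob_space circle_measure
  by (rule prob_space_circle_measure)

lemma AE_circle_measure_iff:
  assumes "{z. P z} \<in> sets borel"
  shows "(AE z in circle_measure. P z) \<longleftrightarrow> (AE t in lborel. t \<in> {0..<2 * pi} \<longrightarrow> P (cis t))"
proof -
  have "(AE z in circle_measure. P z) \<longleftrightarrow> (AE t in uniform_measure lborel {0..<2 * pi}. P (cis t))"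
    unfolding circle_measure_def AE_completion_iff
    using assms by (intro AE_distr_iff) (simp_all add: measurable_cis_uniform)
  also have "\<dots> \<longleftrightarrow> (AE t in lborel. t \<in> {0..<2 * pi} \<longrightarrow> P (cis t))"
    by (rule AE_uniform_measure) auto
  finally show ?thesis .
qed

lemma AE_circle_measure_unit_circle: "AE z in circle_measure. z \<in> unit_circle"
  by (subst AE_circle_measure_iff) auto

lemma AE_circle_measure_neq: "AE z in circle_measure. z \<noteq> c"
proof -
  have *: "{z. z \<noteq> c} \<in> sets borel" by (intro borel_open open_Collect_neq continuous_intros)
  show ?thesis
  proof (cases "\<exists>t0\<in>{0..<2 * pi}. cis t0 = c")
    case True
    then obtain t0 where t0: "t0 \<in> {0..<2 * pi}" "cis t0 = c" by auto
    have "t = t0" if "t \<in> {0..<2 * pi}" "cis t = c" for t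
      using cis_inj_within_period[of t t0] t0 that by auto
    then show ?thesis unfolding AE_circle_measure_iff[OF *]
      using AE_lborel_singleton[of t0] by (auto elim: eventually_mono)
  next
    case False
    then show ?thesis unfolding AE_circle_measure_iff[OF *] by auto
  qed
qed

lemma AE_circle_measure_not_in_finite:
  assumes "finite F"
  shows "AE z in circle_measure. z \<notin> F"
proof -
  have "AE z in circle_measure. \<forall>c\<in>F. z \<noteq> c"
    using assms AE_circle_measure_neq by (intro AE_finite_allI)
  then show ?thesis by eventually_elim auto
qed

text \<open>Full support of arc length, which turns almost-everywhere inequalities for continuous
  functions into pointwise ones.\<close>

lemma not_AE_circle_measure_not_in_open:
  assumes T: "open T" and z0: "z0 \<in> T" "z0 \<in> unit_circle"
  shows "\<not> (AE z in circle_measure. z \<notin> T)"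
proof
  assume ae: "AE z in circle_measure. z \<notin> T"
  have "{z. z \<notin> T} \<in> sets borel" using T by (metis borel_closed closed_Compl Compl_eq)
  then have ae': "AE t in lborel. t \<in> {0..<2 * pi} \<longrightarrow> cis t \<notin> T"
    using ae AE_circle_measure_iff by blast
  obtain t0 where t0: "0 \<le> t0" "t0 < 0 + 2 * pi" "cis t0 = z0"
    using unit_circle_cis_from[OF z0(2)] by blast
  have "open (cis -` T)" using T by (intro open_vimage continuous_intros)
  moreover have "t0 \<in> cis -` T" using t0 z0 by simp
  ultimately obtain e where e: "e > 0" "\<And>t. dist t t0 < e \<Longrightarrow> cis t \<in> T"
    unfolding open_dist by blast
  \<comment> \<open>Only an interval to the right of \<open>t0\<close>, cut at
    \<open>2 * pi\<close>, is used, because \<open>t0\<close> may be the left end of the parameter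
    range.\<close>
  define d where "d = min e (2 * pi - t0)"
  have d: "d > 0" using e t0 by (simp add: d_def)
  have "AE t in lborel. t \<notin> {t0<..<t0 + d}"
    using ae'
  proof eventually_elim
    case (elim t)
    show ?case
    proof
      assume "t \<in> {t0<..<t0 + d}"
      then have "t \<in> {0..<2 * pi}" "dist t t0 < e" using t0 by (auto simp: d_def dist_real_def)
      then show False using elim e(2) by blast
    qed
  qed
  then have "emeasure lborel {t0<..<t0 + d} = 0"
    using AE_iff_null_sets[of "{t0<..<t0 + d}" lborel] by (auto simp: null_sets_def)
  then show False using d by simp
qed

text \<open>\<open>F\<close> holds the end points of the arcs; away from \<open>F\<close> every point of \<open>J\<close> is interior to \<open>J\<close>, so
  isolated points of \<open>J\<close>, which almost-everywhere constraints do not see, all lie in \<open>F\<close>.\<close>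

locale arcs_complement =
  fixes I J :: "complex set" and F :: "complex set"
  assumes J_eq: "J = unit_circle - I"
    and I_openin: "openin (top_of_set unit_circle) I"
    and finite_F: "finite F" and closure_I: "closure I \<subseteq> I \<union> F"
begin

lemma I_subset: "I \<subseteq> unit_circle"
  using openin_imp_subset[OF I_openin] .

lemma closed_J: "closed J"
proof -
  obtain T where T: "open T" "I = unit_circle \<inter> T"
    using I_openin openin_open by blast
  then have "J = unit_circle - T" using J_eq by auto
  then show ?thesis using T(1) by (simp add: closed_Diff)
qed

lemma islimpt_J_imp: "x islimpt J \<Longrightarrow> x \<in> J"
  using closed_J closed_limpt by blast

lemma J_in_sets: "J \<in> sets circle_measure"
  by (intro borel_in_sets_circle_measure borel_closed closed_J)

lemma I_in_sets: "I \<in> sets circle_measure"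
proof -
  have "I = unit_circle - J" using J_eq I_subset by auto
  moreover have "unit_circle - J \<in> sets borel"
    using closed_J by (intro sets.Diff borel_closed) auto
  ultimately show ?thesis using borel_in_sets_circle_measure by simp
qed

text \<open>A violation at \<open>x\<close> persists on a neighbourhood \<open>T\<close>. As
  \<open>F\<close> is finite, \<open>T\<close> contains a point of \<open>J\<close> off
  \<open>F\<close>; around it the circle lies in \<open>J\<close>, so the violation has positive
  measure.\<close>

lemma AE_bound_at_islimpt:
  fixes u :: "complex \<Rightarrow> real"
  assumes u: "continuous_on UNIV u" and ae: "AE z in circle_measure. z \<in> J \<longrightarrow> u z \<le> c"
    and x: "x islimpt J"
  shows "u x \<le> c"
proof (rule ccontr)
  assume "\<not> u x \<le> c"
  define T where "T = {z. c < u z}"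
  have T: "open T" "x \<in> T"
    unfolding T_def using \<open>\<not> u x \<le> c\<close> u by (auto intro!: open_Collect_less)
  have "x islimpt (J - F) \<union> F" using x by (rule islimpt_subset) auto
  then have "x islimpt (J - F)"
    using finite_F islimpt_Un[of x "J - F" F] islimpt_finite by blast
  then obtain y where y: "y \<in> J - F" "y \<in> T" using T unfolding islimpt_def by blast
  then have "y \<in> T - closure I" "y \<in> unit_circle" using closure_I J_eq by auto
  moreover have "open (T - closure I)" using T by (intro open_Diff) auto
  moreover have "AE z in circle_measure. z \<notin> T - closure I"
    using ae AE_circle_measure_unit_circle
  proof eventually_elim
    case (elim z)
    then show ?case using J_eq closure_subset[of I] by (auto simp: T_def)
  qed
  ultimately show False using not_AE_circle_measure_not_in_open by blast
qed

text \<open>Off \<open>closure I\<close> the set \<open>J\<close> is locally the whole circle, and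
  the circle, being connected and not a single point, is perfect.\<close>

lemma J_islimpt:
  assumes "z \<in> J" "z \<notin> F"
  shows "z islimpt J"
proof -
  have z: "z \<in> - closure I" "z \<in> unit_circle" using assms closure_I J_eq by auto
  have "unit_circle \<noteq> {a}" for a :: complex
  proof
    assume "unit_circle = {a}"
    moreover have "1 \<in> unit_circle" "-1 \<in> (unit_circle :: complex set)" by auto
    ultimately have "(1::complex) = -1" by (metis singletonD)
    then show False by simp
  qed
  then have "z islimpt unit_circle"
    using z by (intro connected_imp_perfect connected_sphere) auto
  moreover have "eventually (\<lambda>w. w \<in> - closure I) (at z)"
    using z by (intro eventually_at_in_open') auto
  ultimately have "z islimpt (unit_circle \<inter> - closure I)"
    by (intro islimpt_Int_eventually)
  then show ?thesis by (rule islimpt_subset) (use J_eq closure_subset[of I] in auto)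
qed

lemma AE_J_islimpt: "AE z in circle_measure. z \<in> J \<longrightarrow> z islimpt J"
  using AE_circle_measure_not_in_finite[OF finite_F] by eventually_elim (use J_islimpt in auto)

section \<open>The essential supremum on J\<close>

lemma Linf_norm_on_le_iff:
  assumes "continuous_on UNIV u"
  shows "Linf_norm_on J u \<le> ereal c \<longleftrightarrow> (AE z in circle_measure. z \<in> J \<longrightarrow> cmod (u z) \<le> c)"
proof -
  let ?M = "restrict_space circle_measure J"
  have "(\<lambda>z. ereal (cmod (u z))) \<in> borel_measurable borel"
    using borel_measurable_continuous_onI[OF assms] by measurable
  then have meas: "(\<lambda>z. ereal (cmod (u z))) \<in> borel_measurable ?M"
    by (intro measurable_restrict_space1 borel_measurable_circle_measure)
  have iff: "(AE z in ?M. P z) \<longleftrightarrow> (AE z in circle_measure. z \<in> J \<longrightarrow> P z)" for P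
    using J_in_sets by (intro AE_restrict_space_iff) auto
  show ?thesis
  proof
    assume le: "Linf_norm_on J u \<le> ereal c"
    have "AE z in ?M. ereal (cmod (u z)) \<le> Linf_norm_on J u"
      unfolding Linf_norm_on_def by (rule esssup_AE)
    then have "AE z in ?M. cmod (u z) \<le> c"
      by eventually_elim (use le in \<open>auto dest: order_trans\<close>)
    then show "AE z in circle_measure. z \<in> J \<longrightarrow> cmod (u z) \<le> c" by (simp add: iff)
  next
    assume "AE z in circle_measure. z \<in> J \<longrightarrow> cmod (u z) \<le> c"
    then have "AE z in ?M. ereal (cmod (u z)) \<le> ereal c" by (simp add: iff)
    then show "Linf_norm_on J u \<le> ereal c"
      unfolding Linf_norm_on_def by (intro esssup_I meas)
  qed
qed

lemma Linf_norm_on_bound_at_islimpt: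
  assumes u: "continuous_on UNIV u" and x: "x islimpt J"
  shows "ereal (cmod (u x)) \<le> Linf_norm_on J u"
proof (rule ccontr)
  assume "\<not> ?thesis"
  then have "Linf_norm_on J u < ereal (cmod (u x))" by simp
  \<comment> \<open>The norm is an extended real, while the almost-everywhere criterion takes a real
    bound; density supplies one in between.\<close>
  then obtain c where c: "Linf_norm_on J u < ereal c" "ereal c < ereal (cmod (u x))"
    using ereal_dense2 by blast
  then have "AE z in circle_measure. z \<in> J \<longrightarrow> cmod (u z) \<le> c"
    using Linf_norm_on_le_iff[OF u] by (meson less_imp_le)
  then have "cmod (u x) \<le> c"
    using u x by (intro AE_bound_at_islimpt continuous_intros) auto
  then show False using c by simp
qed

end

section \<open>The extremal problem\<close>

lemma L2_norm_on_sq: "(L2_norm_on I u)\<^sup>2 = (LINT z:I|circle_measure. (cmod (u z))\<^sup>2)"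
proof -
  have "0 \<le> (LINT z:I|circle_measure. (cmod (u z))\<^sup>2)"
    unfolding set_lebesgue_integral_def by (intro integral_nonneg_AE) auto
  then show ?thesis by (simp add: L2_norm_on_def)
qed

lemma L2_norm_on_nonneg: "0 \<le> L2_norm_on I u"
  unfolding L2_norm_on_def set_lebesgue_integral_def by (intro real_sqrt_ge_zero integral_nonneg_AE) auto

lemma
  assumes "set_integrable M I F"
  shows set_integrable_Re: "set_integrable M I (\<lambda>z. Re (F z))"
    and set_integral_Re: "(LINT z:I|M. Re (F z)) = Re (LINT z:I|M. F z)"
proof -
  have eq: "indicator I z *\<^sub>R Re (F z) = Re (indicator I z *\<^sub>R F z)" for z by simp
  show "set_integrable M I (\<lambda>z. Re (F z))"
    using assms unfolding set_integrable_def eq by (rule integrable_Re)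
  show "(LINT z:I|M. Re (F z)) = Re (LINT z:I|M. F z)"
    using assms unfolding set_integrable_def set_lebesgue_integral_def eq by (rule integral_Re)
qed

locale pbep = arcs_complement +
  fixes f :: "complex \<Rightarrow> complex" and n :: nat
  assumes L2_f: "L2_on I f"
begin

lemma bounded_on_circle:
  fixes u :: "complex \<Rightarrow> complex"
  assumes "continuous_on UNIV u"
  obtains C where "0 \<le> C" "\<And>z. z \<in> unit_circle \<Longrightarrow> cmod (u z) \<le> C"
proof -
  have "compact (u ` unit_circle)"
    by (intro compact_continuous_image compact_sphere continuous_on_subset[OF assms]) auto
  then obtain C where C: "\<forall>y\<in>u ` unit_circle. cmod y \<le> C"
    using compact_imp_bounded bounded_iff by blast
  have "cmod (u 1) \<le> C" using C by simp
  then have "0 \<le> C" using norm_ge_zero order_trans by blast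
  then show ?thesis using C by (intro that) auto
qed

lemma continuous_measurable:
  fixes u :: "complex \<Rightarrow> complex"
  assumes "continuous_on UNIV u"
  shows "u \<in> borel_measurable circle_measure"
  by (intro borel_measurable_circle_measure borel_measurable_continuous_onI assms)

lemma set_integrable_continuous:
  fixes u :: "complex \<Rightarrow> complex"
  assumes "continuous_on UNIV u"
  shows "set_integrable circle_measure I u"
proof -
  obtain C where C: "\<And>z. z \<in> unit_circle \<Longrightarrow> cmod (u z) \<le> C"
    using bounded_on_circle[OF assms] by blast
  have "integrable circle_measure u"
    using AE_circle_measure_unit_circle C
    by (intro circle.integrable_const_bound[of u C] continuous_measurable assms) (auto elim: eventually_mono)
  then show ?thesis
    unfolding set_integrable_def using I_in_sets by (intro integrable_mult_indicator)
qed

lemma set_integrable_f_times: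
  assumes u: "continuous_on UNIV u"
  shows "set_integrable circle_measure I (\<lambda>z. f z * u z)"
proof -
  obtain C where C: "0 \<le> C" "\<And>z. z \<in> unit_circle \<Longrightarrow> cmod (u z) \<le> C"
    using bounded_on_circle[OF u] by blast
  have fm: "(\<lambda>z. indicator I z *\<^sub>R f z) \<in> borel_measurable circle_measure"
    using L2_f by (auto simp: L2_on_def set_borel_measurable_def)
  have f2: "integrable circle_measure (\<lambda>z. indicator I z *\<^sub>R (cmod (f z))\<^sup>2)"
    using L2_f by (auto simp: L2_on_def set_integrable_def)
  have eq: "indicator I z *\<^sub>R (f z * u z) = (indicator I z *\<^sub>R f z) * u z" for z by simp
  show ?thesis unfolding set_integrable_def
  proof (rule Bochner_Integration.integrable_bound)
    \<comment> \<open>The dominating function comes from |f| <= 1 + |f|^2; constants are integrable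
      for a probability measure.\<close>
    show "integrable circle_measure (\<lambda>z. C * (1 + indicator I z *\<^sub>R (cmod (f z))\<^sup>2))"
      using f2 by (intro integrable_mult_right Bochner_Integration.integrable_add) auto
    show "(\<lambda>z. indicator I z *\<^sub>R (f z * u z)) \<in> borel_measurable circle_measure"
      unfolding eq using fm continuous_measurable[OF u] by measurable
    show "AE z in circle_measure. norm (indicator I z *\<^sub>R (f z * u z))
        \<le> norm (C * (1 + indicator I z *\<^sub>R (cmod (f z))\<^sup>2))"
      using AE_circle_measure_unit_circle
    proof eventually_elim
      case (elim z)
      have "2 * cmod (f z) \<le> 1 + (cmod (f z))\<^sup>2"
        using zero_le_power2[of "cmod (f z) - 1"] unfolding power2_diff by simp
      then have "cmod (f z) \<le> 1 + (cmod (f z))\<^sup>2"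
        using norm_ge_zero[of "f z"] by linarith
      then have "cmod (f z) * cmod (u z) \<le> (1 + (cmod (f z))\<^sup>2) * C"
        using C(2)[OF elim] by (intro mult_mono) auto
      then show ?case using C(1) by (auto simp: indicator_def norm_mult mult.commute abs_mult)
    qed
  qed
qed

lemma continuous_on_poly_UNIV: "continuous_on UNIV (poly p)" for p :: "complex poly"
  by (intro continuous_intros)

lemma set_integrable_residual_times:
  assumes "continuous_on UNIV u"
  shows "set_integrable circle_measure I (\<lambda>z. (poly p z - f z) * cnj (u z))"
proof -
  have "set_integrable circle_measure I (\<lambda>z. poly p z * cnj (u z) - f z * cnj (u z))"
    using assms by (intro set_integral_diff(1) set_integrable_continuous set_integrable_f_times
        continuous_intros)
  then show ?thesis by (simp add: left_diff_distrib)
qed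

lemma set_integrable_residual_sq:
  "set_integrable circle_measure I (\<lambda>z. (cmod (f z - poly p z))\<^sup>2)"
proof -
  \<comment> \<open>The squared distance is assembled from products already known to be
    integrable.\<close>
  have "set_integrable circle_measure I
      (\<lambda>z. (cmod (f z))\<^sup>2 + (Re ((poly p z - f z) * cnj (poly p z)) - Re (f z * cnj (poly p z))))"
    using L2_f unfolding L2_on_def
    by (intro set_integral_add(1) set_integral_diff(1) set_integrable_Re set_integrable_residual_times
        set_integrable_f_times continuous_intros) auto
  moreover have "(cmod a)\<^sup>2 + (Re ((b - a) * cnj b) - Re (a * cnj b)) = (cmod (a - b))\<^sup>2" for a b
    unfolding cmod_power2 by (simp add: algebra_simps power2_eq_square)
  ultimately show ?thesis by simp
qed

lemma set_integrable_poly_sq: "set_integrable circle_measure I (\<lambda>z. (cmod (poly p z))\<^sup>2)"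
proof -
  have "set_integrable circle_measure I (\<lambda>z. Re (poly p z * cnj (poly p z)))"
    by (intro set_integrable_Re set_integrable_continuous continuous_intros)
  moreover have "Re (a * cnj a) = (cmod a)\<^sup>2" for a
    unfolding cmod_power2 by (simp add: power2_eq_square)
  ultimately show ?thesis by simp
qed

text \<open>An exact quadratic in \<open>t\<close>: its slope at 0 yields the necessary condition,
  its value at 1 sufficiency.\<close>

lemma L2_distance_sq_expand:
  "(L2_norm_on I (\<lambda>z. f z - poly (p + smult (of_real t) h) z))\<^sup>2 =
     (L2_norm_on I (\<lambda>z. f z - poly p z))\<^sup>2 +
     (2 * t * Re (L2_inner_on I (\<lambda>z. poly p z - f z) (poly h)) + t\<^sup>2 * (L2_norm_on I (poly h))\<^sup>2)"
proof -
  let ?R = "\<lambda>z. (poly p z - f z) * cnj (poly h z)"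
  have R: "set_integrable circle_measure I ?R"
    by (intro set_integrable_residual_times continuous_on_poly_UNIV)
  have "(cmod (f z - poly (p + smult (of_real t) h) z))\<^sup>2 =
      (cmod (f z - poly p z))\<^sup>2 + (2 * t * Re (?R z) + t\<^sup>2 * (cmod (poly h z))\<^sup>2)" for z
    unfolding cmod_power2 by (simp add: algebra_simps power2_eq_square)
  then have "(L2_norm_on I (\<lambda>z. f z - poly (p + smult (of_real t) h) z))\<^sup>2 =
      (LINT z:I|circle_measure. (cmod (f z - poly p z))\<^sup>2 +
         (2 * t * Re (?R z) + t\<^sup>2 * (cmod (poly h z))\<^sup>2))"
    by (simp add: L2_norm_on_sq)
  also have "\<dots> = (LINT z:I|circle_measure. (cmod (f z - poly p z))\<^sup>2) +
      (2 * t * (LINT z:I|circle_measure. Re (?R z)) +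
       t\<^sup>2 * (LINT z:I|circle_measure. (cmod (poly h z))\<^sup>2))"
    using set_integrable_Re[OF R] set_integrable_residual_sq set_integrable_poly_sq
    by (simp add: set_integral_add set_integrable_mult_right)
  finally show ?thesis
    by (simp only: L2_norm_on_sq L2_inner_on_def set_integral_Re[OF R])
qed

lemma poly_sum_le_degree: "degree h \<le> n \<Longrightarrow> poly h z = (\<Sum>i\<le>n. coeff h i * z ^ i)"
  for h :: "complex poly"
  unfolding poly_altdef by (intro sum.mono_neutral_left) (auto simp: coeff_eq_0 not_le)

text \<open>Conjugate linearity reduces all pairings to the n + 1 moments against monomials, which
  become the coordinates for Farkas' lemma.\<close>

lemma L2_inner_on_poly:
  assumes "degree h \<le> n"
  shows "L2_inner_on I (\<lambda>z. poly p z - f z) (poly h) =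
    (\<Sum>i\<le>n. cnj (coeff h i) * L2_inner_on I (\<lambda>z. poly p z - f z) (\<lambda>z. z ^ i))"
proof -
  have "(\<lambda>z. (poly p z - f z) * cnj (poly h z)) =
      (\<lambda>z. \<Sum>i\<le>n. cnj (coeff h i) * ((poly p z - f z) * cnj (z ^ i)))"
    by (simp add: poly_sum_le_degree[OF assms] fun_eq_iff sum_distrib_left algebra_simps)
  then have "L2_inner_on I (\<lambda>z. poly p z - f z) (poly h) =
      (LINT z:I|circle_measure. \<Sum>i\<le>n. cnj (coeff h i) * ((poly p z - f z) * cnj (z ^ i)))"
    by (simp add: L2_inner_on_def)
  also have "\<dots> = (\<Sum>i\<le>n. LINT z:I|circle_measure. cnj (coeff h i) * ((poly p z - f z) * cnj (z ^ i)))"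
    unfolding set_lebesgue_integral_def scaleR_sum_right
    by (intro Bochner_Integration.integral_sum, unfold set_integrable_def[symmetric])
      (intro set_integrable_mult_right set_integrable_residual_times continuous_intros)
  also have "\<dots> = (\<Sum>i\<le>n. cnj (coeff h i) * L2_inner_on I (\<lambda>z. poly p z - f z) (\<lambda>z. z ^ i))"
    by (simp add: L2_inner_on_def)
  finally show ?thesis .
qed

text \<open>Points of \<open>J\<close> outside its derived set form a null set, which gives one
  direction; continuity and full support of arc length give the other.\<close>

lemma PBEP_feasible_iff:
  "p \<in> PBEP_feasible J n \<longleftrightarrow> degree p \<le> n \<and> (\<forall>x. x islimpt J \<longrightarrow> cmod (poly p x) \<le> 1)"
proof -
  have "(AE z in circle_measure. z \<in> J \<longrightarrow> cmod (poly p z) \<le> 1) \<longleftrightarrow>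
      (\<forall>x. x islimpt J \<longrightarrow> cmod (poly p x) \<le> 1)"
  proof
    assume "AE z in circle_measure. z \<in> J \<longrightarrow> cmod (poly p z) \<le> 1"
    then show "\<forall>x. x islimpt J \<longrightarrow> cmod (poly p x) \<le> 1"
      using AE_bound_at_islimpt[OF continuous_on_norm[OF continuous_on_poly_UNIV]] by blast
  next
    assume "\<forall>x. x islimpt J \<longrightarrow> cmod (poly p x) \<le> 1"
    then show "AE z in circle_measure. z \<in> J \<longrightarrow> cmod (poly p z) \<le> 1"
      using AE_J_islimpt by (auto elim: eventually_mono)
  qed
  then show ?thesis by (simp add: PBEP_feasible_def)
qed

lemma PBEP_feasible_iff_Linf:
  "p \<in> PBEP_feasible J n \<longleftrightarrow> degree p \<le> n \<and> Linf_norm_on J (poly p) \<le> 1"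
  unfolding PBEP_feasible_def
  using Linf_norm_on_le_iff[OF continuous_on_poly_UNIV, of p 1] by (simp add: one_ereal_def)

lemma PBEP_solution_iff:
  "PBEP_solution I J n f g \<longleftrightarrow> g \<in> PBEP_feasible J n \<and>
     (\<forall>h\<in>PBEP_feasible J n. (L2_norm_on I (\<lambda>z. f z - poly g z))\<^sup>2 \<le> (L2_norm_on I (\<lambda>z. f z - poly h z))\<^sup>2)"
proof -
  define N where "N h = L2_norm_on I (\<lambda>z. f z - poly h z)" for h
  have N0: "0 \<le> N h" for h by (simp add: N_def L2_norm_on_nonneg)
  have bdd: "bdd_below (N ` PBEP_feasible J n)" using N0 by (intro bdd_belowI[of _ 0]) auto
  have "N g = (INF h\<in>PBEP_feasible J n. N h) \<longleftrightarrow> (\<forall>h\<in>PBEP_feasible J n. N g \<le> N h)"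
    if g: "g \<in> PBEP_feasible J n"
  proof
    assume "N g = (INF h\<in>PBEP_feasible J n. N h)"
    then show "\<forall>h\<in>PBEP_feasible J n. N g \<le> N h" using cINF_lower[OF bdd] by simp
  next
    assume "\<forall>h\<in>PBEP_feasible J n. N g \<le> N h"
    then show "N g = (INF h\<in>PBEP_feasible J n. N h)"
      using g cINF_lower[OF bdd g] by (intro antisym cINF_greatest) auto
  qed
  then show ?thesis
    unfolding PBEP_solution_def N_def[symmetric] using N0 power2_le_iff_abs_le
    by (metis (no_types, lifting) power2_le_imp_le power_mono)
qed

section \<open>The first-order condition at a solution\<close>

lemma PBEP_solution_variation:
  assumes sol: "PBEP_solution I J n f g" and d: "0 < d"
    and feas: "\<And>t. 0 < t \<Longrightarrow> t < d \<Longrightarrow> g + smult (of_real t) h \<in> PBEP_feasible J n"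
  shows "0 \<le> Re (L2_inner_on I (\<lambda>z. poly g z - f z) (poly h))"
proof (rule nonneg_slope_at_zero[OF d, of _ "(L2_norm_on I (poly h))\<^sup>2"])
  fix t assume "0 < t" "t < d"
  then have "(L2_norm_on I (\<lambda>z. f z - poly g z))\<^sup>2 \<le>
      (L2_norm_on I (\<lambda>z. f z - poly (g + smult (of_real t) h) z))\<^sup>2"
    using sol feas unfolding PBEP_solution_iff by blast
  then show "0 \<le> 2 * t * Re (L2_inner_on I (\<lambda>z. poly g z - f z) (poly h)) + t\<^sup>2 * (L2_norm_on I (poly h))\<^sup>2"
    unfolding L2_distance_sq_expand by simp
qed

text \<open>The active constraints. For feasible \<open>g\<close>, in contrast to
  \<open>extremal_points\<close>, the set is empty when the norm is below 1, and it omits isolated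
  points of \<open>J\<close>, where competitors are not constrained.\<close>

definition contact_set :: "complex poly \<Rightarrow> complex set" where
  "contact_set g = {x. x islimpt J \<and> cmod (poly g x) = 1}"

lemma compact_islimpt_J: "compact {x. x islimpt J}"
proof -
  have "{x. x islimpt J} \<subseteq> cball 0 1" using islimpt_J_imp J_eq by auto
  then have "bounded {x. x islimpt J}" using bounded_subset[OF bounded_cball] by blast
  then show ?thesis using closed_limpts[of J] by (simp add: compact_eq_bounded_closed)
qed

lemma compact_contact_set: "compact (contact_set g)"
proof -
  have "closed {x. cmod (poly g x) = 1}"
    by (intro closed_Collect_eq continuous_intros)
  then have "compact ({x. x islimpt J} \<inter> {x. cmod (poly g x) = 1})"
    by (intro compact_Int_closed compact_islimpt_J)
  then show ?thesis by (simp add: contact_set_def Collect_conj_eq)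
qed

lemma cmod_add_sq: "(cmod (a + of_real t * b))\<^sup>2 = (cmod a)\<^sup>2 + 2 * t * Re (a * cnj b) + t\<^sup>2 * (cmod b)\<^sup>2"
  unfolding cmod_power2 by (simp add: algebra_simps power2_eq_square)

text \<open>On the compact set \<open>U\<close>, which misses the contact set, \<open>g\<close> has
  a slack \<delta> that absorbs t |h|. Off \<open>U\<close> the first-order decrease t \<epsilon>
  absorbs t^2 |h|^2. These two requirements are the two entries of \<open>d\<close>.\<close>

lemma PBEP_feasible_perturbation:
  assumes g: "g \<in> PBEP_feasible J n" and h: "degree h \<le> n" and \<epsilon>: "0 < \<epsilon>"
    and desc: "\<And>x. x \<in> contact_set g \<Longrightarrow> Re (poly g x * cnj (poly h x)) \<le> - \<epsilon>"
  obtains d where "0 < d" "\<And>t. 0 < t \<Longrightarrow> t < d \<Longrightarrow> g + smult (of_real t) h \<in> PBEP_feasible J n"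
proof -
  obtain C0 where C0: "0 \<le> C0" "\<And>z. z \<in> unit_circle \<Longrightarrow> cmod (poly h z) \<le> C0"
    using bounded_on_circle[OF continuous_on_poly_UNIV] by blast
  \<comment> \<open>The added 1 makes \<open>C\<close> positive, since it becomes a
    denominator.\<close>
  define C where "C = C0 + 1"
  have C: "0 < C" "\<And>z. z islimpt J \<Longrightarrow> cmod (poly h z) \<le> C"
    using C0 islimpt_J_imp J_eq by (fastforce simp: C_def)+
  define U where "U = {x. x islimpt J} \<inter> {x. - \<epsilon> / 2 \<le> Re (poly g x * cnj (poly h x))}"
  have "compact U" unfolding U_def
    by (intro compact_Int_closed compact_islimpt_J closed_Collect_le continuous_intros)
  have g1: "cmod (poly g x) \<le> 1" if "x islimpt J" for x
    using g that by (auto simp: PBEP_feasible_iff)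
  have U1: "cmod (poly g x) < 1" if x: "x \<in> U" for x
  proof -
    have "x \<notin> contact_set g" using desc[of x] x \<epsilon> by (auto simp: U_def)
    then show ?thesis using g1[of x] x by (auto simp: U_def contact_set_def)
  qed
  obtain \<delta> where \<delta>: "0 < \<delta>" "\<And>x. x \<in> U \<Longrightarrow> cmod (poly g x) \<le> 1 - \<delta>"
  proof (cases "U = {}")
    case True
    then show ?thesis using that[of 1] by auto
  next
    case False
    have "continuous_on U (\<lambda>x. cmod (poly g x))" by (intro continuous_intros)
    then obtain y where "y \<in> U" "\<forall>x\<in>U. cmod (poly g x) \<le> cmod (poly g y)"
      using continuous_attains_sup[OF \<open>compact U\<close> False] by blast
    then show ?thesis using U1 by (intro that[of "1 - cmod (poly g y)"]) auto
  qed
  define d where "d = min (\<delta> / C) (\<epsilon> / C\<^sup>2)"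
  have "0 < d" using \<delta>(1) \<epsilon> C(1) by (simp add: d_def)
  moreover have "g + smult (of_real t) h \<in> PBEP_feasible J n" if t: "0 < t" "t < d" for t
    unfolding PBEP_feasible_iff
  proof (intro conjI allI impI)
    show "degree (g + smult (of_real t) h) \<le> n"
      using g h by (intro degree_add_le) (auto simp: PBEP_feasible_def intro: order_trans[OF degree_smult_le])
    fix x assume x: "x islimpt J"
    have tC: "t * C \<le> \<delta>" "t * C\<^sup>2 \<le> \<epsilon>"
      using t C(1) by (auto simp: d_def field_simps)
    show "cmod (poly (g + smult (of_real t) h) x) \<le> 1"
    proof (cases "x \<in> U")
      case True
      have "cmod (poly (g + smult (of_real t) h) x) \<le> cmod (poly g x) + t * cmod (poly h x)"
        using norm_triangle_ineq[of "poly g x" "of_real t * poly h x"] t by (simp add: norm_mult)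
      also have "\<dots> \<le> (1 - \<delta>) + t * C"
        using \<delta>(2)[OF True] C(2)[OF x] t by (intro add_mono mult_left_mono) auto
      finally show ?thesis using tC(1) by simp
    next
      case False
      then have neg: "Re (poly g x * cnj (poly h x)) \<le> - \<epsilon> / 2" using x by (simp add: U_def)
      have "(cmod (poly g x))\<^sup>2 \<le> 1" using g1[OF x] by (simp add: power_le_one)
      moreover have "2 * t * Re (poly g x * cnj (poly h x)) \<le> 2 * t * (- \<epsilon> / 2)"
        using neg t by (intro mult_left_mono) auto
      moreover have "t\<^sup>2 * (cmod (poly h x))\<^sup>2 \<le> t\<^sup>2 * C\<^sup>2"
        using C(2)[OF x] by (intro mult_left_mono power_mono) auto
      moreover have "t\<^sup>2 * C\<^sup>2 \<le> t * \<epsilon>"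
        using tC(2) t by (simp add: power2_eq_square mult.assoc)
      ultimately have "(cmod (poly g x + of_real t * poly h x))\<^sup>2 \<le> 1"
        unfolding cmod_add_sq by simp
      then have "cmod (poly g x + of_real t * poly h x) \<le> 1"
        using power2_le_imp_le[of _ 1] by simp
      then show ?thesis by simp
    qed
  qed
  ultimately show ?thesis using that by blast
qed

text \<open>Since |g| = 1 on the contact set, h - t g descends there by at least t and is an
  admissible direction. This gives \<phi>(h) >= t \<phi>(g) for every t in (0,1), and the claim in
  the limit.\<close>

lemma PBEP_solution_first_order:
  assumes sol: "PBEP_solution I J n f g" and h: "degree h \<le> n"
    and desc: "\<And>x. x \<in> contact_set g \<Longrightarrow> Re (poly g x * cnj (poly h x)) \<le> 0"
  shows "0 \<le> Re (L2_inner_on I (\<lambda>z. poly g z - f z) (poly h))"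
proof (rule nonneg_slope_at_zero[OF zero_less_one])
  fix t :: real assume t: "0 < t" "t < 1"
  let ?\<phi> = "\<lambda>h. Re (L2_inner_on I (\<lambda>z. poly g z - f z) (poly h))"
  have g: "g \<in> PBEP_feasible J n" "degree g \<le> n"
    using sol by (auto simp: PBEP_solution_def PBEP_feasible_def)
  define k where "k = h - smult (of_real t) g"
  have k: "degree k \<le> n"
    unfolding k_def using h g by (intro degree_diff_le) (auto intro: order_trans[OF degree_smult_le])
  have "Re (poly g x * cnj (poly k x)) \<le> - t" if x: "x \<in> contact_set g" for x
  proof -
    have "Re (poly g x * cnj (poly k x)) = Re (poly g x * cnj (poly h x)) - t * (cmod (poly g x))\<^sup>2"
      unfolding cmod_power2 by (simp add: k_def algebra_simps power2_eq_square)
    then show ?thesis using desc[OF x] x by (simp add: contact_set_def)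
  qed
  then obtain d where "0 < d" "\<And>s. 0 < s \<Longrightarrow> s < d \<Longrightarrow> g + smult (of_real s) k \<in> PBEP_feasible J n"
    using PBEP_feasible_perturbation[OF g(1) k t(1)] by blast
  then have "0 \<le> ?\<phi> k" using PBEP_solution_variation[OF sol] by blast
  moreover have "?\<phi> k = ?\<phi> h - t * ?\<phi> g"
    unfolding L2_inner_on_poly[OF k] L2_inner_on_poly[OF h] L2_inner_on_poly[OF g(2)]
    by (simp add: k_def sum_distrib_left sum_subtractf algebra_simps)
  ultimately have "0 \<le> 2 * t * (?\<phi> h - t * ?\<phi> g)" using t by simp
  then show "0 \<le> 2 * t * ?\<phi> h + t\<^sup>2 * (- 2 * ?\<phi> g)"
    by (simp add: algebra_simps power2_eq_square)
qed

section \<open>Existence of multipliers, in real coordinates\<close>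

lemma PBEP_solution_multipliers:
  assumes sol: "PBEP_solution I J n f g"
  obtains X l where "finite X" "X \<subseteq> contact_set g" "card X \<le> 2 * n + 2" "\<And>x. x \<in> X \<Longrightarrow> 0 \<le> l x"
    "\<And>h. degree h \<le> n \<Longrightarrow> L2_inner_on I (\<lambda>z. poly g z - f z) (poly h) +
       (\<Sum>x\<in>X. of_real (l x) * poly g x * cnj (poly h x)) = 0"
proof -
  have deg_g: "degree g \<le> n" using sol by (auto simp: PBEP_solution_def PBEP_feasible_def)
  define \<phi> where "\<phi> h = L2_inner_on I (\<lambda>z. poly g z - f z) h" for h
  define part where "part b z = (if b then Re z else Im z)" for b :: bool and z
  \<comment> \<open>The flag selects real or imaginary part, so \<open>B\<close> indexes the real
    coordinates of P_n; its cardinality is the bound 2n + 2.\<close>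
  define B where "B = {..n} \<times> (UNIV :: bool set)"
  \<comment> \<open>\<open>V x\<close> lists the complex coordinates of h |-> g(x) cnj (h(x));
    \<open>v x\<close> are its real coordinates and \<open>w\<close> those of minus the residual
    pairing.\<close>
  define V where "V x i = poly g x * cnj (x ^ i)" for x :: complex and i :: nat
  define v where "v x = (\<lambda>(i, b). part b (V x i))" for x
  define w where "w = (\<lambda>(i, b). part b (- \<phi> (\<lambda>z. z ^ i)))"
  have sum_B: "(\<Sum>k\<in>B. F k) = (\<Sum>i\<le>n. \<Sum>b\<in>UNIV. F (i, b))" for F :: "nat \<times> bool \<Rightarrow> real"
    unfolding B_def sum.cartesian_product by (simp add: split_def)
  \<comment> \<open>The real dot product of coordinate vectors is the real part of the Hermitian
    pairing.\<close>
  have pair: "(\<Sum>k\<in>B. (case k of (i, b) \<Rightarrow> part b (c i)) * h k) =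
      Re (\<Sum>i\<le>n. c i * cnj (Complex (h (i, True)) (h (i, False))))" for c h
    unfolding sum_B by (simp add: UNIV_bool part_def add.commute)
  have V_poly: "(\<Sum>i\<le>n. V x i * cnj (coeff h i)) = poly g x * cnj (poly h x)"
    if "degree h \<le> n" for x h
    unfolding V_def poly_sum_le_degree[OF that, of x] by (simp add: sum_distrib_left algebra_simps)
  have \<phi>_poly: "\<phi> (poly h) = (\<Sum>i\<le>n. cnj (coeff h i) * \<phi> (\<lambda>z. z ^ i))" if "degree h \<le> n" for h
    unfolding \<phi>_def by (rule L2_inner_on_poly[OF that])
  obtain X l where X: "finite X" "X \<subseteq> contact_set g" "card X \<le> card B"
    "\<And>x. x \<in> X \<Longrightarrow> 0 \<le> l x" "\<And>k. k \<in> B \<Longrightarrow> w k = (\<Sum>x\<in>X. l x * v x k)"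
  \<comment> \<open>The normalizing functional has the coefficients of \<open>g\<close>: on the
    generator at \<open>x\<close> it takes the value |g(x)|^2 = 1.\<close>
  proof (rule farkas_compact_base[of B "contact_set g" v "\<lambda>(i, b). part b (coeff g i)" w])
    show "finite B" by (simp add: B_def)
    show "compact (contact_set g)" by (rule compact_contact_set)
    show "continuous_on (contact_set g) (\<lambda>x. v x k)" for k
      by (cases k; cases "snd k") (auto simp: v_def part_def V_def intro!: continuous_intros)
    show "(\<Sum>k\<in>B. v x k * (case k of (i, b) \<Rightarrow> part b (coeff g i))) = 1" if x: "x \<in> contact_set g" for x
    proof -
      have "(\<Sum>k\<in>B. v x k * (case k of (i, b) \<Rightarrow> part b (coeff g i))) =
          Re (\<Sum>i\<le>n. V x i * cnj (coeff g i))"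
        unfolding v_def pair by (simp add: part_def)
      also have "\<dots> = (cmod (poly g x))\<^sup>2"
        unfolding V_poly[OF deg_g] cmod_power2 by (simp add: power2_eq_square)
      finally show ?thesis using x by (simp add: contact_set_def)
    qed
    show "(\<Sum>k\<in>B. w k * c k) \<le> 0" if c: "\<And>x. x \<in> contact_set g \<Longrightarrow> (\<Sum>k\<in>B. v x k * c k) \<le> 0" for c
    proof -
      \<comment> \<open>The test vector \<open>c\<close> is decoded into a polynomial, to which the
        first-order condition applies.\<close>
      define h where "h = (\<Sum>i\<le>n. monom (Complex (c (i, True)) (c (i, False))) i)"
      have h: "degree h \<le> n" unfolding h_def
        by (intro degree_sum_le) (auto intro: order_trans[OF degree_monom_le])
      have coeff_h: "coeff h i = Complex (c (i, True)) (c (i, False))" if "i \<le> n" for i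
        using that by (simp add: h_def coeff_sum coeff_monom sum.delta)
      have "(\<Sum>k\<in>B. v x k * c k) = Re (poly g x * cnj (poly h x))" for x
        unfolding V_poly[OF h, symmetric] v_def pair by (simp add: coeff_h)
      then have "0 \<le> Re (\<phi> (poly h))"
        unfolding \<phi>_def using c by (intro PBEP_solution_first_order[OF sol h]) auto
      moreover have "(\<Sum>k\<in>B. w k * c k) = Re (\<Sum>i\<le>n. - (cnj (coeff h i) * \<phi> (\<lambda>z. z ^ i)))"
        unfolding w_def pair
        by (intro arg_cong[where f = Re] sum.cong refl) (simp add: coeff_h mult.commute)
      ultimately show ?thesis unfolding \<phi>_poly[OF h] by (simp add: sum_negf)
    qed
  qed blast
  \<comment> \<open>The equations for both flags combine into one complex identity per monomial,
    which extends to P_n by conjugate linearity.\<close>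
  have moment: "\<phi> (\<lambda>z. z ^ i) + (\<Sum>x\<in>X. of_real (l x) * V x i) = 0" if "i \<le> n" for i
    using X(5)[of "(i, True)"] X(5)[of "(i, False)"] that
    by (auto simp: complex_eq_iff w_def v_def part_def B_def)
  have "\<phi> (poly h) + (\<Sum>x\<in>X. of_real (l x) * poly g x * cnj (poly h x)) = 0" if h: "degree h \<le> n" for h
  proof -
    have "(\<Sum>x\<in>X. of_real (l x) * poly g x * cnj (poly h x)) =
        (\<Sum>x\<in>X. \<Sum>i\<le>n. cnj (coeff h i) * (of_real (l x) * V x i))"
      by (simp only: mult.assoc V_poly[OF h, symmetric] sum_distrib_left) (simp only: mult_ac)
    also have "\<dots> = (\<Sum>i\<le>n. cnj (coeff h i) * (\<Sum>x\<in>X. of_real (l x) * V x i))"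
      by (subst sum.swap) (simp add: sum_distrib_left)
    finally have "\<phi> (poly h) + (\<Sum>x\<in>X. of_real (l x) * poly g x * cnj (poly h x)) =
        (\<Sum>i\<le>n. cnj (coeff h i) * (\<phi> (\<lambda>z. z ^ i) + (\<Sum>x\<in>X. of_real (l x) * V x i)))"
      unfolding \<phi>_poly[OF h] by (simp add: sum.distrib distrib_left)
    then show ?thesis using moment by simp
  qed
  moreover have "card B = 2 * n + 2" by (simp add: B_def card_cartesian_product)
  ultimately show ?thesis using X unfolding \<phi>_def by (intro that[of X l]) auto
qed

section \<open>From contact points to extremal points, and sufficiency\<close>

lemma contact_set_extremal:
  assumes g: "g \<in> PBEP_feasible J n" and x: "x \<in> contact_set g"
  shows "x \<in> extremal_points J g" "Linf_norm_on J (poly g) = 1"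
proof -
  have "1 \<le> Linf_norm_on J (poly g)"
    using Linf_norm_on_bound_at_islimpt[OF continuous_on_poly_UNIV, of x g] x
    by (auto simp: contact_set_def one_ereal_def)
  then show "Linf_norm_on J (poly g) = 1" using g PBEP_feasible_iff_Linf by (auto intro: antisym)
  then show "x \<in> extremal_points J g"
    using x islimpt_J_imp by (auto simp: extremal_points_def contact_set_def one_ereal_def)
qed

lemma PBEP_solution_imp_multipliers:
  assumes sol: "PBEP_solution I J n f g"
  shows "\<exists>r x l. PBEP_multipliers I J n f g r x l \<and> (r > 0 \<longrightarrow> Linf_norm_on J (poly g) = 1) \<and>
           (\<forall>j\<in>{1..r}. x j islimpt J)"
proof -
  have g: "g \<in> PBEP_feasible J n" using sol by (simp add: PBEP_solution_def)
  obtain X l where X: "finite X" "X \<subseteq> contact_set g" "card X \<le> 2 * n + 2" "\<And>x. x \<in> X \<Longrightarrow> 0 \<le> l x"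
    "\<And>h. degree h \<le> n \<Longrightarrow> L2_inner_on I (\<lambda>z. poly g z - f z) (poly h) +
       (\<Sum>x\<in>X. of_real (l x) * poly g x * cnj (poly h x)) = 0"
    by (rule PBEP_solution_multipliers[OF sol]) blast
  obtain e where e: "bij_betw e {1..card X} X"
    using ex_bij_betw_nat_finite_1[OF X(1)] by blast
  have eX: "e j \<in> X" if "j \<in> {1..card X}" for j using e that by (auto simp: bij_betw_def)
  have sum_e: "(\<Sum>j = 1..card X. of_real (l (e j)) * poly g (e j) * cnj (poly h (e j))) =
      (\<Sum>x\<in>X. of_real (l x) * poly g x * cnj (poly h x))" for h
    by (rule sum.reindex_bij_betw[OF e, of "\<lambda>x. of_real (l x) * poly g x * cnj (poly h x)"])
  have contact: "e j \<in> contact_set g" if "j \<in> {1..card X}" for j using eX[OF that] X(2) by blast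
  have "PBEP_multipliers I J n f g (card X) e (\<lambda>j. l (e j))"
    unfolding PBEP_multipliers_def sum_e
    using X(3-5) e eX contact contact_set_extremal(1)[OF g] by (auto simp: bij_betw_def)
  moreover have "card X > 0 \<longrightarrow> Linf_norm_on J (poly g) = 1"
    using contact_set_extremal(2)[OF g contact[of 1]] by auto
  moreover have "\<forall>j\<in>{1..card X}. e j islimpt J" using contact by (auto simp: contact_set_def)
  ultimately show ?thesis by (intro exI[of _ "card X"] exI[of _ e] exI[of _ "\<lambda>j. l (e j)"] conjI)
qed

text \<open>At each \<open>x j\<close>, \<open>act\<close> gives |g| = 1 and \<open>lim\<close>
  gives |h| <= 1 for a competitor \<open>h\<close>. So Re (g cnj (h - g)) <= 0 there, the multiplier
  identity yields Re <g - f, h - g> >= 0, and the expansion at t = 1 concludes.\<close>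

lemma multipliers_imp_PBEP_solution:
  assumes deg_g: "degree g \<le> n" and le: "Linf_norm_on J (poly g) \<le> 1"
    and mult: "PBEP_multipliers I J n f g r x l"
    and act: "r > 0 \<Longrightarrow> Linf_norm_on J (poly g) = 1" and lim: "\<And>j. j \<in> {1..r} \<Longrightarrow> x j islimpt J"
  shows "PBEP_solution I J n f g"
  unfolding PBEP_solution_iff
proof (intro conjI ballI)
  show "g \<in> PBEP_feasible J n" using deg_g le by (simp add: PBEP_feasible_iff_Linf)
  fix h assume h: "h \<in> PBEP_feasible J n"
  then have deg: "degree (h - g) \<le> n"
    using deg_g by (intro degree_diff_le) (auto simp: PBEP_feasible_def)
  have "Re (of_real (l j) * poly g (x j) * cnj (poly (h - g) (x j))) \<le> 0" if j: "j \<in> {1..r}" for j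
  proof -
    have "x j \<in> extremal_points J g" "0 \<le> l j" using mult j by (auto simp: PBEP_multipliers_def)
    then have g1: "cmod (poly g (x j)) = 1"
      using act j by (auto simp: extremal_points_def one_ereal_def)
    have h1: "cmod (poly h (x j)) \<le> 1" using h lim[OF j] by (simp add: PBEP_feasible_iff)
    have "Re (poly g (x j) * cnj (poly h (x j))) \<le> cmod (poly g (x j) * cnj (poly h (x j)))"
      by (rule complex_Re_le_cmod)
    also have "\<dots> \<le> 1" using g1 h1 by (simp add: norm_mult)
    also have "1 = Re (poly g (x j) * cnj (poly g (x j)))"
      using g1 cmod_power2[of "poly g (x j)"] by (simp add: power2_eq_square)
    finally have "l j * Re (poly g (x j) * cnj (poly (h - g) (x j))) \<le> 0"
      using \<open>0 \<le> l j\<close> by (intro mult_nonneg_nonpos) (simp_all add: algebra_simps)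
    then show ?thesis by (simp add: algebra_simps)
  qed
  then have "Re (\<Sum>j = 1..r. of_real (l j) * poly g (x j) * cnj (poly (h - g) (x j))) \<le> 0"
    unfolding Re_sum by (intro sum_nonpos)
  moreover have "L2_inner_on I (\<lambda>z. poly g z - f z) (poly (h - g)) =
      - (\<Sum>j = 1..r. of_real (l j) * poly g (x j) * cnj (poly (h - g) (x j)))"
    using mult deg unfolding PBEP_multipliers_def by (metis add_eq_0_iff2)
  ultimately have "0 \<le> Re (L2_inner_on I (\<lambda>z. poly g z - f z) (poly (h - g)))"
    by simp
  then show "(L2_norm_on I (\<lambda>z. f z - poly g z))\<^sup>2 \<le> (L2_norm_on I (\<lambda>z. f z - poly h z))\<^sup>2"
    using L2_distance_sq_expand[of g 1 "h - g"] by simp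
qed

section \<open>The bound on the multipliers\<close>

lemma Re_residual_inner_le:
  "- Re (L2_inner_on I (\<lambda>z. poly g z - f z) (poly g)) \<le> (L2_norm_on I f)\<^sup>2"
proof -
  have R: "set_integrable circle_measure I (\<lambda>z. (poly g z - f z) * cnj (poly g z))"
    by (intro set_integrable_residual_times continuous_on_poly_UNIV)
  have f2: "set_integrable circle_measure I (\<lambda>z. (cmod (f z))\<^sup>2)" using L2_f by (simp add: L2_on_def)
  have pointwise: "0 \<le> Re ((b - a) * cnj b) + (cmod a)\<^sup>2" for a b
  proof -
    \<comment> \<open>Completing the square in \<open>b\<close>, which stands for the value of
      \<open>g\<close>, with \<open>a\<close> for that of \<open>f\<close>.\<close>
    have "Re ((b - a) * cnj b) + (cmod a)\<^sup>2 = (cmod (b - a / 2))\<^sup>2 + 3 / 4 * (cmod a)\<^sup>2"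
      unfolding cmod_power2 by (simp add: field_simps power2_eq_square)
    then show ?thesis by simp
  qed
  have "0 \<le> (LINT z:I|circle_measure. Re ((poly g z - f z) * cnj (poly g z)) + (cmod (f z))\<^sup>2)"
    unfolding set_lebesgue_integral_def using pointwise
    by (intro integral_nonneg_AE AE_I2) (simp add: indicator_def)
  also have "\<dots> = Re (L2_inner_on I (\<lambda>z. poly g z - f z) (poly g)) + (L2_norm_on I f)\<^sup>2"
    unfolding set_integral_add(2)[OF set_integrable_Re[OF R] f2] set_integral_Re[OF R]
    by (simp only: L2_inner_on_def L2_norm_on_sq)
  finally show ?thesis by simp
qed

text \<open>The zeros of a nonzero polynomial form a null set, whereas a relative interior point
  gives \<open>J\<close> positive measure.\<close>

lemma Linf_norm_on_pos:
  assumes int: "(top_of_set unit_circle) interior_of J \<noteq> {}" and "g \<noteq> 0"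
  shows "\<not> Linf_norm_on J (poly g) \<le> 0"
proof
  assume "Linf_norm_on J (poly g) \<le> 0"
  then have "AE z in circle_measure. z \<in> J \<longrightarrow> cmod (poly g z) \<le> 0"
    using Linf_norm_on_le_iff[OF continuous_on_poly_UNIV, of g 0] by (simp add: zero_ereal_def)
  moreover have "finite {z. poly g z = 0}" using \<open>g \<noteq> 0\<close> by (rule poly_roots_finite)
  then have "AE z in circle_measure. z \<notin> {z. poly g z = 0}"
    by (rule AE_circle_measure_not_in_finite)
  ultimately have notJ: "AE z in circle_measure. z \<notin> J" by eventually_elim auto
  obtain x where "x \<in> (top_of_set unit_circle) interior_of J" using int by blast
  then obtain V where "openin (top_of_set unit_circle) V" "x \<in> V" "V \<subseteq> J"
    by (auto simp: interior_of_def)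
  then obtain T where T: "open T" "x \<in> unit_circle \<inter> T" "unit_circle \<inter> T \<subseteq> J"
    using openin_open by metis
  have "AE z in circle_measure. z \<notin> T"
    using notJ AE_circle_measure_unit_circle by eventually_elim (use T(3) in blast)
  then show False using not_AE_circle_measure_not_in_open[OF T(1), of x] T(2) by blast
qed

text \<open>With M the common value of |g(x_j)|, testing with h = g equates M^2 times the sum with
  -Re <g - f, g>. If M < 1, slightly enlarging \<open>g\<close> stays feasible, which makes this
  nonpositive. For \<open>g = 0\<close> the multiplier terms vanish and the nonnegative weights
  would be arbitrary, hence \<open>nz\<close>.\<close>

lemma multipliers_sum_le:
  assumes int: "(top_of_set unit_circle) interior_of J \<noteq> {}"
    and sol: "PBEP_solution I J n f g" and mult: "PBEP_multipliers I J n f g r x l"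
    and nz: "g = 0 \<Longrightarrow> r = 0"
  shows "(\<Sum>j = 1..r. l j) \<le> (L2_norm_on I f)\<^sup>2"
proof (cases "r = 0")
  case True
  then show ?thesis by simp
next
  case False
  have g: "g \<in> PBEP_feasible J n" and deg_g: "degree g \<le> n" and le: "Linf_norm_on J (poly g) \<le> 1"
    using sol by (auto simp: PBEP_solution_def PBEP_feasible_iff_Linf)
  define M where "M = cmod (poly g (x 1))"
  have ext: "x j \<in> extremal_points J g" if "j \<in> {1..r}" for j
    using mult that by (auto simp: PBEP_multipliers_def)
  have Linf: "Linf_norm_on J (poly g) = ereal M"
    using ext[of 1] False by (auto simp: extremal_points_def M_def)
  have "g \<noteq> 0" using nz False by auto
  then have M: "M \<le> 1" "0 < M"
    using le Linf Linf_norm_on_pos[OF int \<open>g \<noteq> 0\<close>] by (simp_all add: one_ereal_def zero_ereal_def)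
  have xM: "cmod (poly g (x j)) = M" if "j \<in> {1..r}" for j
    using ext[OF that] Linf by (auto simp: extremal_points_def)
  have "Re (L2_inner_on I (\<lambda>z. poly g z - f z) (poly g) +
      (\<Sum>j = 1..r. of_real (l j) * poly g (x j) * cnj (poly g (x j)))) = 0"
    using mult deg_g by (auto simp: PBEP_multipliers_def)
  moreover have "Re (\<Sum>j = 1..r. of_real (l j) * poly g (x j) * cnj (poly g (x j))) =
      M\<^sup>2 * (\<Sum>j = 1..r. l j)"
    unfolding Re_sum sum_distrib_left
  proof (intro sum.cong refl)
    fix j assume "j \<in> {1..r}"
    then show "Re (of_real (l j) * poly g (x j) * cnj (poly g (x j))) = M\<^sup>2 * l j"
      using xM cmod_power2[of "poly g (x j)"] by (simp add: power2_eq_square algebra_simps)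
  qed
  ultimately have eq: "M\<^sup>2 * (\<Sum>j = 1..r. l j) = - Re (L2_inner_on I (\<lambda>z. poly g z - f z) (poly g))"
    by simp
  show ?thesis
  proof (cases "M = 1")
    case True
    then show ?thesis using eq Re_residual_inner_le[of g] by simp
  next
    case False
    \<comment> \<open>Scaling by 1 + t keeps the norm (1 + t) M at most 1 as long as t is at most
      \<open>1 / M - 1\<close>.\<close>
    have "g + smult (of_real t) g \<in> PBEP_feasible J n" if t: "0 < t" "t < 1 / M - 1" for t
      unfolding PBEP_feasible_iff
    proof (intro conjI allI impI)
      show "degree (g + smult (of_real t) g) \<le> n"
        using deg_g by (intro degree_add_le) (auto intro: order_trans[OF degree_smult_le])
      fix z assume "z islimpt J"
      then have "cmod (poly g z) \<le> M"
        using Linf_norm_on_bound_at_islimpt[OF continuous_on_poly_UNIV, of z g] Linf by simp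
      then have "(1 + t) * cmod (poly g z) \<le> (1 + t) * M" using t by (intro mult_left_mono) auto
      also have "\<dots> \<le> 1" using t M by (simp add: field_simps)
      finally have "cmod (of_real (1 + t) * poly g z) \<le> 1"
        using t by (simp only: norm_mult norm_of_real)
      then show "cmod (poly (g + smult (of_real t) g) z) \<le> 1" by (simp add: algebra_simps)
    qed
    moreover have "0 < 1 / M - 1" using M False by (simp add: field_simps)
    ultimately have "0 \<le> Re (L2_inner_on I (\<lambda>z. poly g z - f z) (poly g))"
      using PBEP_solution_variation[OF sol] by blast
    then have "M\<^sup>2 * (\<Sum>j = 1..r. l j) \<le> 0" using eq by simp
    then have "(\<Sum>j = 1..r. l j) \<le> 0" using M by (simp add: mult_le_0_iff)
    then show ?thesis by (rule order_trans[OF _ zero_le_power2])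
  qed
qed

end

theorem theorem2:
  fixes I J :: "complex set" and n :: nat and f :: "complex \<Rightarrow> complex" and g :: "complex poly"
  assumes "finite_union_of_open_arcs I"
    and "J = unit_circle - I"
    and "(top_of_set unit_circle) interior_of J \<noteq> {}"
    and "L2_on I f"
    and "degree g \<le> n"
  shows "(PBEP_solution I J n f g \<longleftrightarrow>
            Linf_norm_on J (poly g) \<le> 1 \<and>
            (\<exists>r x l. PBEP_multipliers I J n f g r x l \<and>
                     (r > 0 \<longrightarrow> Linf_norm_on J (poly g) = 1) \<and>
                     (\<forall>j\<in>{1..r}. x j islimpt J)))
       \<and> (\<forall>r x l. PBEP_solution I J n f g \<and> PBEP_multipliers I J n f g r x l \<and>
                  (g = 0 \<longrightarrow> r = 0) \<longrightarrow>
                  (\<Sum>j = 1..r. l j) \<le> 2 * (L2_norm_on I f)\<^sup>2)"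
proof -
  obtain F where F: "finite F" "closure I \<subseteq> I \<union> F"
    using finite_union_of_open_arcs_closure[OF assms(1)] by blast
  interpret pbep I J F f n
    using assms(2,4) F finite_union_of_open_arcs_openin[OF assms(1)] by unfold_locales
  show ?thesis
  proof (intro conjI allI impI iffI)
    assume "PBEP_solution I J n f g"
    then show "Linf_norm_on J (poly g) \<le> 1"
      by (simp add: PBEP_solution_def PBEP_feasible_iff_Linf)
  next
    assume "PBEP_solution I J n f g"
    then show "\<exists>r x l. PBEP_multipliers I J n f g r x l \<and> (r > 0 \<longrightarrow> Linf_norm_on J (poly g) = 1) \<and>
        (\<forall>j\<in>{1..r}. x j islimpt J)"
      by (rule PBEP_solution_imp_multipliers)
  next
    assume "Linf_norm_on J (poly g) \<le> 1 \<and> (\<exists>r x l. PBEP_multipliers I J n f g r x l \<and>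
        (r > 0 \<longrightarrow> Linf_norm_on J (poly g) = 1) \<and> (\<forall>j\<in>{1..r}. x j islimpt J))"
    then show "PBEP_solution I J n f g"
      using multipliers_imp_PBEP_solution[OF assms(5)] by blast
  next
    fix r x l
    assume "PBEP_solution I J n f g \<and> PBEP_multipliers I J n f g r x l \<and> (g = 0 \<longrightarrow> r = 0)"
    then have "(\<Sum>j = 1..r. l j) \<le> (L2_norm_on I f)\<^sup>2"
      using multipliers_sum_le[OF assms(3)] by blast
    \<comment> \<open>The argument yields the constant 1, which is weakened to 2.\<close>
    then show "(\<Sum>j = 1..r. l j) \<le> 2 * (L2_norm_on I f)\<^sup>2"
      using zero_le_power2[of "L2_norm_on I f"] by linarith
  qed
qed

end
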